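(* The sequence of categories $\mathbf A_1,\mathbf A_2,\dots,\mathbf A_n,\dots$ (the Catalan groupoids), with the composition functors $Q_{n,t,\pi}$, has the structure of a (non-$\Sigma$, non-unital) operad in $\mathbf{Cat}$.
   Context: A (non-$\Sigma$, non-unital) operad $\mathcal O$ in $\mathbf{Cat}$ consists of categories $\mathcal O_j$, $j\ge1$, and composition functors $Q:\mathcal O_k\times\mathcal O_{j_1}\times\cdots\times\mathcal O_{j_k}\to\mathcal O_{j_1+\cdots+j_k}$ such that for all $k$, $j_1,\dots,j_k$ with $j=\sum j_s$, $i_1,\dots,i_j$ with $i=\sum i_t$, $g_s=j_1+\cdots+j_s$ and $h_s=i_{g_{s-1}+1}+\cdots+i_{g_s}$, the two functors $\mathcal O_k\times\prod_{s=1}^k\mathcal O_{j_s}\times\prod_{r=1}^j\mathcal O_{i_r}\to\mathcal O_i$ agree: (1) $Q\times\mathrm{Id}$ to $\mathcal O_j\times\prod_{r}\mathcal O_{i_r}$ followed by $Q$; (2) the shuffle to $\mathcal O_k\times\prod_{s=1}^k\big(\mathcal O_{j_s}\times\prod_{q=1}^{j_s}\mathcal O_{i_{g_{s-1}+q}}\big)$ followed by $\mathrm{Id}\times\prod_sQ$ to $\mathcal O_k\times\prod_s\mathcal O_{h_s}$ followed by $Q$. Catalan groupoids: let $\mathbf I$ (resp. $\dot{\mathbf I}$) be the indiscrete (resp. discrete) category with two objects $0,1$, and $\iota:0\to1$ the nontrivial isomorphism. Groupoids $\mathbf A_n$ ($n\ge1$) and functors $U_{a,b}:\mathbf A_a\times\mathbf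 A_b\to\mathbf A_{a+b}$, $V_{i,j,k}:\mathbf A_i\times\mathbf A_j\times\mathbf A_k\times\mathbf I\to\mathbf A_{i+j+k}$ are defined inductively (indices positive). $\mathbf A_1=\mathbf 1$ with one object $*$. For $n\ge2$, $\mathbf A_n$ is the pushout of categories of $$\coprod_{i+j+k=n}\mathbf A_i\times\mathbf A_j\times\mathbf A_k\times\mathbf I\ \hookleftarrow\ \coprod_{i+j+k=n}\mathbf A_i\times\mathbf A_j\times\mathbf A_k\times\dot{\mathbf I}\ \xrightarrow{W_{i,j,k}}\ \coprod_{a+b=n}\mathbf A_a\times\mathbf A_b,$$ $W_{i,j,k}(f,g,h,0)=(f,U_{j,k}(g,h))$, $W_{i,j,k}(f,g,h,1)=(U_{i,j}(f,g),h)$ (similarly on morphisms); $V_{i,j,k},U_{a,b}$ are the structure maps. Functors $Q$: for $n\le t$ and an order-preserving surjection $\pi:\{1,\dots,t\}\to\{1,\dots,n\}$ with $m_i=|\pi^{-1}(i)|$, the functor $Q=Q_{n,t,\pi}:\mathbf A_n\times\mathbf A_{m_1}\times\cdots\times\mathbf A_{m_n}\to\mathbf A_t$ is defined by induction on $n$: $Q_{1,t,\pi}$ is the projection $\mathbf A_1\times\mathbf A_t\to\mathbf A_t$; on objects (for $n\ge 2$), each $f\in\mathbf A_n$ is $U_{a,b}(f_1,f_2)$ for unique $a,b,f_1,f_2$ with $a+b=n$, and $Q(f,g_1,\dots,g_n)=U_{a,b}$-type tensor of the two substitutions, i.e. $U_{t_1,t_2}(Q(f_1,g_1,\dots,g_a),Q(f_2,g_{a+1},\dots,g_n))$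 with $t_1=m_1+\cdots+m_a$, $t_2=m_{a+1}+\cdots+m_n$; on morphisms it is determined by functoriality from the same formula for $\phi=U_{a,b}(\phi_1,\phi_2)$, and, for $\phi=V_{i,j,k}(\phi_1,\phi_2,\phi_3,\iota)$, by $Q(\phi,\gamma_1,\dots,\gamma_n)=V_{t_i,t_j,t_k}(Q(\phi_1,\gamma_1,\dots,\gamma_i),Q(\phi_2,\gamma_{i+1},\dots,\gamma_{i+j}),Q(\phi_3,\gamma_{i+j+1},\dots,\gamma_n),\iota)$, where $t_i,t_j,t_k$ are the sums of the corresponding $m_x$'s. *)

theory Defs
  imports Main
begin

section \<open>Small categories and functors\<close>

text \<open>
  A category is given by carrier sets of objects and arrows; \<open>Cmp C g f\<close> is the composite
  \<open>g \<circ> f\<close>.  The operations are unconstrained outside the carriers, so equality of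
  functors is taken on the carriers of the source category.
\<close>

record ('o, 'a) cat =
  Obj :: "'o set"
  Arr :: "'a set"
  Dom :: "'a \<Rightarrow> 'o"
  Cod :: "'a \<Rightarrow> 'o"
  Idn :: "'o \<Rightarrow> 'a"
  Cmp :: "'a \<Rightarrow> 'a \<Rightarrow> 'a"

record ('o, 'a, 'p, 'b) fctr =
  omap :: "'o \<Rightarrow> 'p"
  amap :: "'a \<Rightarrow> 'b"

definition category :: "('o, 'a) cat \<Rightarrow> bool" where
  "category C \<longleftrightarrow>
    (\<forall>f\<in>Arr C. Dom C f \<in> Obj C \<and> Cod C f \<in> Obj C) \<and>
    (\<forall>x\<in>Obj C. Idn C x \<in> Arr C \<and> Dom C (Idn C x) = x \<and> Cod C (Idn C x) = x) \<and>
    (\<forall>g\<in>Arr C. \<forall>f\<in>Arr C. Dom C g = Cod C f \<longrightarrow>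
       Cmp C g f \<in> Arr C \<and> Dom C (Cmp C g f) = Dom C f \<and> Cod C (Cmp C g f) = Cod C g) \<and>
    (\<forall>f\<in>Arr C. Cmp C (Idn C (Cod C f)) f = f \<and> Cmp C f (Idn C (Dom C f)) = f) \<and>
    (\<forall>h\<in>Arr C. \<forall>g\<in>Arr C. \<forall>f\<in>Arr C. Dom C h = Cod C g \<longrightarrow> Dom C g = Cod C f \<longrightarrow>
       Cmp C (Cmp C h g) f = Cmp C h (Cmp C g f))"

definition is_functor ::
  "('o, 'a) cat \<Rightarrow> ('p, 'b) cat \<Rightarrow> ('o, 'a, 'p, 'b) fctr \<Rightarrow> bool" where
  "is_functor C D F \<longleftrightarrow> category C \<and> category D \<and>
    (\<forall>x\<in>Obj C. omap F x \<in> Obj D \<and> amap F (Idn C x) = Idn D (omap F x)) \<and>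
    (\<forall>f\<in>Arr C. amap F f \<in> Arr D \<and>
       Dom D (amap F f) = omap F (Dom C f) \<and> Cod D (amap F f) = omap F (Cod C f)) \<and>
    (\<forall>g\<in>Arr C. \<forall>f\<in>Arr C. Dom C g = Cod C f \<longrightarrow>
       amap F (Cmp C g f) = Cmp D (amap F g) (amap F f))"

definition functor_eq ::
  "('o, 'a) cat \<Rightarrow> ('o, 'a, 'p, 'b) fctr \<Rightarrow> ('o, 'a, 'p, 'b) fctr \<Rightarrow> bool" where
  "functor_eq C F G \<longleftrightarrow>
    (\<forall>x\<in>Obj C. omap F x = omap G x) \<and> (\<forall>f\<in>Arr C. amap F f = amap G f)"

definition id_functor :: "('o, 'a, 'o, 'a) fctr" where
  "id_functor = \<lparr>omap = (\<lambda>x. x), amap = (\<lambda>f. f)\<rparr>"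

definition comp_functor ::
  "('p, 'b, 'q, 'c) fctr \<Rightarrow> ('o, 'a, 'p, 'b) fctr \<Rightarrow> ('o, 'a, 'q, 'c) fctr" where
  "comp_functor G F = \<lparr>omap = omap G \<circ> omap F, amap = amap G \<circ> amap F\<rparr>"

definition prod_cat :: "('o, 'a) cat \<Rightarrow> ('p, 'b) cat \<Rightarrow> ('o \<times> 'p, 'a \<times> 'b) cat" where
  "prod_cat C D = \<lparr>Obj = Obj C \<times> Obj D, Arr = Arr C \<times> Arr D,
     Dom = map_prod (Dom C) (Dom D), Cod = map_prod (Cod C) (Cod D),
     Idn = map_prod (Idn C) (Idn D),
     Cmp = (\<lambda>(g, g') (f, f'). (Cmp C g f, Cmp D g' f'))\<rparr>"

definition prod_functor ::
  "('o, 'a, 'p, 'b) fctr \<Rightarrow> ('o2, 'a2, 'p2, 'b2) fctr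
     \<Rightarrow> ('o \<times> 'o2, 'a \<times> 'a2, 'p \<times> 'p2, 'b \<times> 'b2) fctr" where
  "prod_functor F G = \<lparr>omap = map_prod (omap F) (omap G), amap = map_prod (amap F) (amap G)\<rparr>"

text \<open>The product of a finite sequence of categories; its objects and arrows are lists.\<close>

definition list_cat :: "('o, 'a) cat list \<Rightarrow> ('o list, 'a list) cat" where
  "list_cat Cs = \<lparr>
     Obj = {xs. list_all2 (\<lambda>x C. x \<in> Obj C) xs Cs},
     Arr = {fs. list_all2 (\<lambda>f C. f \<in> Arr C) fs Cs},
     Dom = map2 Dom Cs, Cod = map2 Cod Cs, Idn = map2 Idn Cs,
     Cmp = (\<lambda>gs fs. map2 (\<lambda>C (g, f). Cmp C g f) Cs (zip gs fs))\<rparr>"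

definition list_functor :: "('o, 'a, 'p, 'b) fctr list \<Rightarrow> ('o list, 'a list, 'p list, 'b list) fctr" where
  "list_functor Fs = \<lparr>omap = map2 omap Fs, amap = map2 amap Fs\<rparr>"

definition coprod_cat :: "'i set \<Rightarrow> ('i \<Rightarrow> ('o, 'a) cat) \<Rightarrow> ('i \<times> 'o, 'i \<times> 'a) cat" where
  "coprod_cat I C = \<lparr>Obj = Sigma I (\<lambda>i. Obj (C i)), Arr = Sigma I (\<lambda>i. Arr (C i)),
     Dom = (\<lambda>(i, f). (i, Dom (C i) f)), Cod = (\<lambda>(i, f). (i, Cod (C i) f)),
     Idn = (\<lambda>(i, x). (i, Idn (C i) x)),
     Cmp = (\<lambda>(i, g) (i', f). (i, Cmp (C i) g f))\<rparr>"

definition copair :: "('i \<Rightarrow> ('o, 'a, 'p, 'b) fctr) \<Rightarrow> ('i \<times> 'o, 'i \<times> 'a, 'p, 'b) fctr" where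
  "copair F = \<lparr>omap = (\<lambda>(i, x). omap (F i) x), amap = (\<lambda>(i, f). amap (F i) f)\<rparr>"


section \<open>Operads in Cat\<close>

text \<open>
  The composition functor \<open>\<O>\<^sub>k \<times> \<O>\<^bsub>j1\<^esub> \<times> \<dots> \<times> \<O>\<^bsub>jk\<^esub> \<rightarrow> \<O>\<^bsub>j1+\<dots>+jk\<^esub>\<close> is indexed by the
  list \<open>js = [j1, \<dots>, jk]\<close>, so \<open>k = length js\<close>.  Only the categories \<open>\<O> j\<close> with \<open>j \<ge> 1\<close> matter.
\<close>

fun chunks :: "nat list \<Rightarrow> 'x list \<Rightarrow> 'x list list" where
  "chunks [] xs = []"
| "chunks (j # js) xs = take j xs # chunks js (drop j xs)"

definition shuffle :: "nat list \<Rightarrow> ('x \<times> 'y list) \<times> 'z list \<Rightarrow> 'x \<times> ('y \<times> 'z list) list" where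
  "shuffle js = (\<lambda>((x, ys), zs). (x, zip ys (chunks js zs)))"

definition shuffle_functor where
  "shuffle_functor js = \<lparr>omap = shuffle js, amap = shuffle js\<rparr>"

definition operad_in_Cat ::
  "(nat \<Rightarrow> ('o, 'a) cat) \<Rightarrow> (nat list \<Rightarrow> ('o \<times> 'o list, 'a \<times> 'a list, 'o, 'a) fctr) \<Rightarrow> bool" where
  "operad_in_Cat \<O> Q \<longleftrightarrow>
    (\<forall>j\<ge>1. category (\<O> j)) \<and>
    (\<forall>js. js \<noteq> [] \<longrightarrow> (\<forall>j\<in>set js. 1 \<le> j) \<longrightarrow>
       is_functor (prod_cat (\<O> (length js)) (list_cat (map \<O> js))) (\<O> (sum_list js)) (Q js)) \<and>
    (\<forall>js is. js \<noteq> [] \<longrightarrow> (\<forall>j\<in>set js. 1 \<le> j) \<longrightarrow> (\<forall>i\<in>set is. 1 \<le> i) \<longrightarrow>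
       length is = sum_list js \<longrightarrow>
       functor_eq
         (prod_cat (prod_cat (\<O> (length js)) (list_cat (map \<O> js))) (list_cat (map \<O> is)))
         (comp_functor (Q is) (prod_functor (Q js) id_functor))
         (comp_functor (Q (map sum_list (chunks js is)))
           (comp_functor (prod_functor id_functor (list_functor (map Q (chunks js is))))
             (shuffle_functor js))))"


section \<open>The Catalan groupoids\<close>

datatype endpt = Zero | One

definition indisc :: "(endpt, endpt \<times> endpt) cat" where
  "indisc = \<lparr>Obj = UNIV, Arr = UNIV, Dom = fst, Cod = snd,
     Idn = (\<lambda>x. (x, x)), Cmp = (\<lambda>g f. (fst f, snd g))\<rparr>"

definition disc :: "(endpt, endpt \<times> endpt) cat" where
  "disc = indisc\<lparr>Arr := {(x, x) | x. True}\<rparr>"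

text \<open>
  Since \<open>disc\<close> and \<open>indisc\<close> have the same objects, the objects of the pushout defining the
  \<open>n\<close>-th groupoid are those of the coproduct over \<open>a + b = n\<close>: binary trees with \<open>n\<close> leaves.
  The arrows of all the groupoids are presented at once: \<open>raw\<close> arrows are formal composites of
  the images \<open>U\<close>, \<open>V\<close> of arrows of the two coproducts, and \<open>\<sim>\<close> is the congruence generated by
  the category axioms, functoriality of \<open>U\<close> and \<open>V\<close>, and commutativity of the pushout square.
  In \<open>V \<phi> \<psi> \<chi> s t\<close>, the pair \<open>(s, t)\<close> is the arrow \<open>s \<rightarrow> t\<close> of \<open>indisc\<close>.  That this
  gives the terminal category for \<open>n = 1\<close> and the iterated pushouts for \<open>n \<ge> 2\<close> is shown in
  \<open>catalan_1\<close>, \<open>catalan_square_commutes\<close> and \<open>catalan_pushout\<close> below.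
\<close>

datatype tree = Leaf | Node tree tree

primrec leaves :: "tree \<Rightarrow> nat" where
  "leaves Leaf = 1"
| "leaves (Node x y) = leaves x + leaves y"

datatype raw = Star | U raw raw | V raw raw raw endpt endpt | Comp raw raw

definition Vtree :: "tree \<Rightarrow> tree \<Rightarrow> tree \<Rightarrow> endpt \<Rightarrow> tree" where
  "Vtree x y z s = (case s of Zero \<Rightarrow> Node x (Node y z) | One \<Rightarrow> Node (Node x y) z)"

definition Vraw :: "raw \<Rightarrow> raw \<Rightarrow> raw \<Rightarrow> endpt \<Rightarrow> raw" where
  "Vraw x y z s = (case s of Zero \<Rightarrow> U x (U y z) | One \<Rightarrow> U (U x y) z)"

primrec src :: "raw \<Rightarrow> tree" where
  "src Star = Leaf"
| "src (U a b) = Node (src a) (src b)"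
| "src (V a b c s t) = Vtree (src a) (src b) (src c) s"
| "src (Comp b a) = src a"

primrec tgt :: "raw \<Rightarrow> tree" where
  "tgt Star = Leaf"
| "tgt (U a b) = Node (tgt a) (tgt b)"
| "tgt (V a b c s t) = Vtree (tgt a) (tgt b) (tgt c) t"
| "tgt (Comp b a) = tgt b"

primrec typed :: "raw \<Rightarrow> bool" where
  "typed Star \<longleftrightarrow> True"
| "typed (U a b) \<longleftrightarrow> typed a \<and> typed b"
| "typed (V a b c s t) \<longleftrightarrow> typed a \<and> typed b \<and> typed c"
| "typed (Comp b a) \<longleftrightarrow> typed b \<and> typed a \<and> src b = tgt a"

abbreviation arity :: "raw \<Rightarrow> nat" where
  "arity a \<equiv> leaves (src a)"

primrec ident :: "tree \<Rightarrow> raw" where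
  "ident Leaf = Star"
| "ident (Node x y) = U (ident x) (ident y)"

inductive eqv :: "raw \<Rightarrow> raw \<Rightarrow> bool" (infix "\<sim>" 50) where
  eqv_refl: "typed a \<Longrightarrow> a \<sim> a"
| eqv_sym: "a \<sim> b \<Longrightarrow> b \<sim> a"
| eqv_trans [trans]: "a \<sim> b \<Longrightarrow> b \<sim> c \<Longrightarrow> a \<sim> c"
| U_cong: "a \<sim> a' \<Longrightarrow> b \<sim> b' \<Longrightarrow> U a b \<sim> U a' b'"
| V_cong: "a \<sim> a' \<Longrightarrow> b \<sim> b' \<Longrightarrow> c \<sim> c' \<Longrightarrow> V a b c s t \<sim> V a' b' c' s t"
| Comp_cong: "a \<sim> a' \<Longrightarrow> b \<sim> b' \<Longrightarrow> src a = tgt b \<Longrightarrow> Comp a b \<sim> Comp a' b'"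
| eqv_assoc: "typed (Comp (Comp a b) c) \<Longrightarrow> Comp (Comp a b) c \<sim> Comp a (Comp b c)"
| id_left: "typed a \<Longrightarrow> Comp (ident (tgt a)) a \<sim> a"
| id_right: "typed a \<Longrightarrow> Comp a (ident (src a)) \<sim> a"
| U_Comp: "typed (Comp a' a) \<Longrightarrow> typed (Comp b' b) \<Longrightarrow>
     U (Comp a' a) (Comp b' b) \<sim> Comp (U a' b') (U a b)"
| V_Comp: "typed (Comp a' a) \<Longrightarrow> typed (Comp b' b) \<Longrightarrow> typed (Comp c' c) \<Longrightarrow>
     V (Comp a' a) (Comp b' b) (Comp c' c) s u \<sim> Comp (V a' b' c' t u) (V a b c s t)"
| V_end: "typed a \<Longrightarrow> typed b \<Longrightarrow> typed c \<Longrightarrow> V a b c s s \<sim> Vraw a b c s"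

definition cls :: "raw \<Rightarrow> raw set" where
  "cls a = {b. a \<sim> b}"

definition rep :: "raw set \<Rightarrow> raw" where
  "rep f = (SOME a. a \<in> f)"

definition catalan :: "nat \<Rightarrow> (tree, raw set) cat" where
  "catalan n = \<lparr>
     Obj = {x. leaves x = n},
     Arr = {cls a | a. typed a \<and> leaves (src a) = n},
     Dom = (\<lambda>f. src (rep f)), Cod = (\<lambda>f. tgt (rep f)),
     Idn = (\<lambda>x. cls (ident x)),
     Cmp = (\<lambda>g f. cls (Comp (rep g) (rep f)))\<rparr>"

text \<open>
  The structure functors \<open>U\<^bsub>a,b\<^esub>\<close> and \<open>V\<^bsub>i,j,k\<^esub>\<close> of the pushouts, and \<open>W\<^bsub>i,j,k\<^esub>\<close> with values in
  the coproduct over \<open>a + b = n\<close>.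
\<close>

definition Ufun :: "(tree \<times> tree, raw set \<times> raw set, tree, raw set) fctr" where
  "Ufun = \<lparr>omap = (\<lambda>(x, y). Node x y), amap = (\<lambda>(f, g). cls (U (rep f) (rep g)))\<rparr>"

definition Vfun :: "(tree \<times> tree \<times> tree \<times> endpt,
    raw set \<times> raw set \<times> raw set \<times> endpt \<times> endpt, tree, raw set) fctr" where
  "Vfun = \<lparr>omap = (\<lambda>(x, y, z, s). Vtree x y z s),
     amap = (\<lambda>(f, g, h, s, t). cls (V (rep f) (rep g) (rep h) s t))\<rparr>"

definition Wfun :: "nat \<times> nat \<times> nat \<Rightarrow> (tree \<times> tree \<times> tree \<times> endpt,
    raw set \<times> raw set \<times> raw set \<times> endpt \<times> endpt,
    (nat \<times> nat) \<times> tree \<times> tree, (nat \<times> nat) \<times> raw set \<times> raw set) fctr" where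
  "Wfun = (\<lambda>(i, j, k). \<lparr>
     omap = (\<lambda>(x, y, z, s). case s of
        Zero \<Rightarrow> ((i, j + k), x, omap Ufun (y, z))
      | One \<Rightarrow> ((i + j, k), omap Ufun (x, y), z)),
     amap = (\<lambda>(f, g, h, s, t). case s of
        Zero \<Rightarrow> ((i, j + k), f, amap Ufun (g, h))
      | One \<Rightarrow> ((i + j, k), amap Ufun (f, g), h))\<rparr>)"

definition pairs :: "nat \<Rightarrow> (nat \<times> nat) set" where
  "pairs n = {(a, b). 1 \<le> a \<and> 1 \<le> b \<and> a + b = n}"

definition triples :: "nat \<Rightarrow> (nat \<times> nat \<times> nat) set" where
  "triples n = {(i, j, k). 1 \<le> i \<and> 1 \<le> j \<and> 1 \<le> k \<and> i + j + k = n}"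

definition Usum :: "nat \<Rightarrow> ((nat \<times> nat) \<times> tree \<times> tree, (nat \<times> nat) \<times> raw set \<times> raw set) cat" where
  "Usum n = coprod_cat (pairs n) (\<lambda>(a, b). prod_cat (catalan a) (catalan b))"

definition Vsum :: "(endpt, endpt \<times> endpt) cat \<Rightarrow> nat \<Rightarrow>
    ((nat \<times> nat \<times> nat) \<times> tree \<times> tree \<times> tree \<times> endpt,
     (nat \<times> nat \<times> nat) \<times> raw set \<times> raw set \<times> raw set \<times> endpt \<times> endpt) cat" where
  "Vsum J n = coprod_cat (triples n)
     (\<lambda>(i, j, k). prod_cat (catalan i) (prod_cat (catalan j) (prod_cat (catalan k) J)))"


lemma eqv_wf: "a \<sim> b \<Longrightarrow> typed a \<and> typed b \<and> src a = src b \<and> tgt a = tgt b"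
proof -
  have i: "src (ident x) = x \<and> tgt (ident x) = x \<and> typed (ident x)" for x
    by (induction x) auto
  show "a \<sim> b \<Longrightarrow> ?thesis"
    by (induction rule: eqv.induct) (auto simp: i Vraw_def Vtree_def split: endpt.splits)
qed

lemma ident [simp]: "src (ident x) = x" "tgt (ident x) = x" "typed (ident x)"
  by (induction x) auto

lemma leaves_pos: "1 \<le> leaves x"
  by (induction x) auto

lemma leaves_Vtree [simp]: "leaves (Vtree x y z s) = leaves x + leaves y + leaves z"
  by (simp add: Vtree_def split: endpt.splits)

lemma leaves_tgt: "typed a \<Longrightarrow> leaves (tgt a) = leaves (src a)"
  by (induction a) auto

lemma cls_eq: "typed a \<Longrightarrow> cls a = cls b \<longleftrightarrow> a \<sim> b"
proof
  assume "typed a" "cls a = cls b"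
  then have "a \<in> cls b" using eqv_refl by (auto simp: cls_def)
  then show "a \<sim> b" by (auto simp: cls_def intro: eqv_sym)
qed (auto simp: cls_def intro: eqv_sym eqv_trans)

lemma eqv_cls: "a \<sim> b \<Longrightarrow> cls a = cls b"
  using cls_eq eqv_wf by blast

lemma rep_eqv: "typed a \<Longrightarrow> rep (cls a) \<sim> a"
  unfolding rep_def cls_def by (rule eqv_sym, rule someI2[of _ a]) (auto intro: eqv_refl)

lemma rep_cls [simp]:
  assumes "typed a"
  shows "typed (rep (cls a))" "src (rep (cls a)) = src a" "tgt (rep (cls a)) = tgt a"
  using rep_eqv[OF assms] eqv_wf by auto

lemma cls_rep [simp]: "typed a \<Longrightarrow> cls (rep (cls a)) = cls a"
  using rep_eqv eqv_cls by blast

lemma Arr_catalan: "f \<in> Arr (catalan n) \<Longrightarrow> typed (rep f) \<and> cls (rep f) = f \<and> arity (rep f) = n"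
  by (auto simp: catalan_def)

lemma cls_Arr: "typed a \<Longrightarrow> arity a = n \<Longrightarrow> cls a \<in> Arr (catalan n)"
  by (auto simp: catalan_def)

lemma Cmp_catalan:
  "typed a \<Longrightarrow> typed b \<Longrightarrow> src b = tgt a \<Longrightarrow> Cmp (catalan n) (cls b) (cls a) = cls (Comp b a)"
  by (auto simp: catalan_def cls_eq intro: Comp_cong rep_eqv)

lemma DomCod_catalan [simp]: "typed a \<Longrightarrow> Dom (catalan n) (cls a) = src a"
  "typed a \<Longrightarrow> Cod (catalan n) (cls a) = tgt a"
  by (auto simp: catalan_def)

lemma Idn_catalan [simp]: "Idn (catalan n) x = cls (ident x)"
  by (simp add: catalan_def)

lemma Obj_catalan [simp]: "x \<in> Obj (catalan n) \<longleftrightarrow> leaves x = n"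
  by (simp add: catalan_def)

lemma Arr_catalanE:
  assumes "f \<in> Arr (catalan n)" obtains a where "f = cls a" "typed a" "arity a = n"
  using assms by (auto simp: catalan_def)

lemma amap_Ufun: "typed a \<Longrightarrow> typed b \<Longrightarrow> amap Ufun (cls a, cls b) = cls (U a b)"
  by (auto simp: Ufun_def cls_eq intro: U_cong rep_eqv)

lemma amap_Vfun: "typed a \<Longrightarrow> typed b \<Longrightarrow> typed c \<Longrightarrow>
    amap Vfun (cls a, cls b, cls c, s, t) = cls (V a b c s t)"
  by (auto simp: Vfun_def cls_eq intro: V_cong rep_eqv)

lemma category_catalan: "category (catalan n)"
proof -
  have "f \<in> Arr (catalan n) \<Longrightarrow> Dom (catalan n) f \<in> Obj (catalan n) \<and> Cod (catalan n) f \<in> Obj (catalan n)" for f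
    by (auto elim!: Arr_catalanE simp: leaves_tgt)
  moreover have "x \<in> Obj (catalan n) \<Longrightarrow> Idn (catalan n) x \<in> Arr (catalan n) \<and>
     Dom (catalan n) (Idn (catalan n) x) = x \<and> Cod (catalan n) (Idn (catalan n) x) = x" for x
    by (auto intro!: cls_Arr)
  moreover have "Cmp (catalan n) g f \<in> Arr (catalan n) \<and> Dom (catalan n) (Cmp (catalan n) g f) = Dom (catalan n) f
      \<and> Cod (catalan n) (Cmp (catalan n) g f) = Cod (catalan n) g"
    if "g \<in> Arr (catalan n)" "f \<in> Arr (catalan n)" "Dom (catalan n) g = Cod (catalan n) f" for f g
    using that by (auto elim!: Arr_catalanE simp: Cmp_catalan intro!: cls_Arr)
  moreover have "Cmp (catalan n) (Idn (catalan n) (Cod (catalan n) f)) f = f \<and>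
      Cmp (catalan n) f (Idn (catalan n) (Dom (catalan n) f)) = f" if f: "f \<in> Arr (catalan n)" for f
  proof -
    obtain a where "f = cls a" "typed a" by (rule Arr_catalanE[OF f])
    then show ?thesis by (simp add: Cmp_catalan eqv_cls[OF id_left] eqv_cls[OF id_right])
  qed
  moreover have "Cmp (catalan n) (Cmp (catalan n) h g) f = Cmp (catalan n) h (Cmp (catalan n) g f)"
    if hgf: "h \<in> Arr (catalan n)" "g \<in> Arr (catalan n)" "f \<in> Arr (catalan n)"
      "Dom (catalan n) h = Cod (catalan n) g" "Dom (catalan n) g = Cod (catalan n) f" for f g h
  proof -
    obtain c where c: "h = cls c" "typed c" by (rule Arr_catalanE[OF hgf(1)])
    obtain b where b: "g = cls b" "typed b" by (rule Arr_catalanE[OF hgf(2)])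
    obtain a where a: "f = cls a" "typed a" by (rule Arr_catalanE[OF hgf(3)])
    have "src c = tgt b" "src b = tgt a" using hgf(4,5) a b c by simp_all
    then show ?thesis using a b c by (simp add: Cmp_catalan eqv_cls[OF eqv_assoc])
  qed
  ultimately show ?thesis unfolding category_def by simp
qed

lemma category_id:
  assumes "category C" "f \<in> Arr C"
  shows "Cmp C (Idn C (Cod C f)) f = f" "Cmp C f (Idn C (Dom C f)) = f"
  using assms by (simp_all add: category_def)

lemma category_prod: "category C \<Longrightarrow> category D \<Longrightarrow> category (prod_cat C D)"
  unfolding category_def prod_cat_def by auto

lemma category_coprod: "(\<And>i. i \<in> I \<Longrightarrow> category (C i)) \<Longrightarrow> category (coprod_cat I C)"
  unfolding category_def coprod_cat_def by auto

lemma category_indisc: "category indisc" "category disc"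
  unfolding category_def indisc_def disc_def by auto

lemma category_Usum: "category (Usum n)"
  unfolding Usum_def by (rule category_coprod) (auto intro: category_prod category_catalan)

lemma category_Vsum: "category J \<Longrightarrow> category (Vsum J n)"
  unfolding Vsum_def by (rule category_coprod) (auto intro: category_prod category_catalan)

lemma leaves_1: "leaves x = 1 \<longleftrightarrow> x = Leaf"
proof (cases x)
  case (Node y z)
  then show ?thesis using leaves_pos[of y] leaves_pos[of z] by simp
qed simp

lemma eqv_Star: "typed a \<Longrightarrow> src a = Leaf \<Longrightarrow> a \<sim> Star"
proof (induction a)
  case (Comp b a)
  then have "a \<sim> Star" by simp
  then have "tgt a = Leaf" using eqv_wf[of a Star] by simp
  then have "b \<sim> Star" using Comp by simp
  with \<open>a \<sim> Star\<close> have "Comp b a \<sim> Comp Star Star" using Comp.prems by (auto intro: Comp_cong)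
  also have "Comp Star Star \<sim> Star" using id_left[of Star] by simp
  finally show ?case .
qed (auto intro: eqv_refl simp: Vtree_def split: endpt.splits)

lemma catalan_1: "Obj (catalan 1) = {Leaf}" "Arr (catalan 1) = {cls Star}"
proof -
  show "Obj (catalan 1) = {Leaf}" using leaves_1 by (auto simp: catalan_def)
  have "f = cls Star" if f: "f \<in> Arr (catalan 1)" for f
  proof -
    obtain a where a: "f = cls a" "typed a" "arity a = 1" by (rule Arr_catalanE[OF f])
    then have "a \<sim> Star" using leaves_1 eqv_Star by metis
    with a show ?thesis using eqv_cls by simp
  qed
  moreover have "cls Star \<in> Arr (catalan 1)" by (rule cls_Arr) simp_all
  ultimately show "Arr (catalan 1) = {cls Star}" by blast
qed

lemmas sum_simps = Usum_def Vsum_def coprod_cat_def prod_cat_def copair_def pairs_def triples_def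

lemma functor_copair:
  assumes "\<And>i. i \<in> I \<Longrightarrow> is_functor (C i) D (F i)" "category D"
  shows "is_functor (coprod_cat I C) D (copair F)"
proof -
  have "category (coprod_cat I C)"
    using assms by (intro category_coprod) (auto simp: is_functor_def)
  with assms show ?thesis
    unfolding is_functor_def by (auto simp: coprod_cat_def copair_def)
qed

lemma catalan_functorI:
  assumes "category C"
    and "\<And>x. x \<in> Obj C \<Longrightarrow> leaves (omap F x) = n \<and> amap F (Idn C x) = cls (ident (omap F x))"
    and "\<And>f. f \<in> Arr C \<Longrightarrow>
      \<exists>a. amap F f = cls a \<and> typed a \<and> src a = omap F (Dom C f) \<and> tgt a = omap F (Cod C f)"
    and "\<And>g f a b. g \<in> Arr C \<Longrightarrow> f \<in> Arr C \<Longrightarrow> Dom C g = Cod C f \<Longrightarrow> amap F g = cls b \<Longrightarrow>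
      amap F f = cls a \<Longrightarrow> typed (Comp b a) \<Longrightarrow> amap F (Cmp C g f) = cls (Comp b a)"
  shows "is_functor C (catalan n) F"
proof -
  have "amap F f \<in> Arr (catalan n) \<and> Dom (catalan n) (amap F f) = omap F (Dom C f)
      \<and> Cod (catalan n) (amap F f) = omap F (Cod C f)" if f: "f \<in> Arr C" for f
  proof -
    have "Dom C f \<in> Obj C" using f assms(1) by (simp add: category_def)
    then show ?thesis using assms(2)[of "Dom C f"] assms(3)[OF f] cls_Arr by auto
  qed
  moreover have "amap F (Cmp C g f) = Cmp (catalan n) (amap F g) (amap F f)"
    if gf: "g \<in> Arr C" "f \<in> Arr C" "Dom C g = Cod C f" for g f
  proof -
    obtain b where b: "amap F g = cls b" "typed b" "src b = omap F (Dom C g)"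
      using assms(3)[OF gf(1)] by blast
    obtain a where a: "amap F f = cls a" "typed a" "tgt a = omap F (Cod C f)"
      using assms(3)[OF gf(2)] by blast
    show ?thesis using assms(4)[OF gf b(1) a(1)] a b gf(3) by (simp add: Cmp_catalan)
  qed
  ultimately show ?thesis
    using assms(1,2) category_catalan unfolding is_functor_def by simp
qed

lemma Ufun: "is_functor (prod_cat (catalan a) (catalan b)) (catalan (a + b)) Ufun"
proof -
  have o: "omap Ufun = (\<lambda>(x, y). Node x y)" by (simp add: Ufun_def)
  show ?thesis
  proof (rule catalan_functorI, goal_cases)
    case 1
    then show ?case by (intro category_prod category_catalan)
  next
    case (2 x)
    then show ?case by (auto simp: prod_cat_def o amap_Ufun)
  next
    case (3 f)
    then obtain c d where "f = (cls c, cls d)" "typed c" "typed d"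
      by (auto simp: prod_cat_def elim!: Arr_catalanE)
    then show ?case by (auto simp: prod_cat_def o amap_Ufun intro!: exI[of _ "U c d"])
  next
    case (4 g f a' b')
    obtain c d where f: "f = (cls c, cls d)" "typed c" "typed d"
      using 4(2) by (auto simp: prod_cat_def elim!: Arr_catalanE)
    obtain c' d' where g: "g = (cls c', cls d')" "typed c'" "typed d'"
      using 4(1) by (auto simp: prod_cat_def elim!: Arr_catalanE)
    have m: "src c' = tgt c" "src d' = tgt d"
      using 4(3) f g by (auto simp: prod_cat_def)
    have "U c' d' \<sim> b'" "U c d \<sim> a'" 
      using 4(4,5) f g by (auto simp: amap_Ufun simp flip: cls_eq)
    then have "Comp (U c' d') (U c d) \<sim> Comp b' a'"
      using m by (auto intro: Comp_cong)
    moreover have "U (Comp c' c) (Comp d' d) \<sim> Comp (U c' d') (U c d)"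
      using m f g by (auto intro: U_Comp)
    ultimately have "U (Comp c' c) (Comp d' d) \<sim> Comp b' a'"
      by (rule eqv_trans[rotated])
    then show ?case
      using f g m by (simp add: prod_cat_def Cmp_catalan amap_Ufun eqv_cls)
  qed
qed

lemma is_functor_U: "is_functor (Usum n) (catalan n) (copair (\<lambda>_. Ufun))"
  unfolding Usum_def
  by (rule functor_copair) (auto simp: pairs_def category_catalan intro: Ufun)

lemma Vfun: "is_functor (prod_cat (catalan i) (prod_cat (catalan j) (prod_cat (catalan k) indisc)))
    (catalan (i + j + k)) Vfun"
proof -
  have o: "omap Vfun = (\<lambda>(x, y, z, s). Vtree x y z s)" by (simp add: Vfun_def)
  have e: "V (ident x) (ident y) (ident z) s s \<sim> ident (Vtree x y z s)" for x y z s
    using V_end[of "ident x" "ident y" "ident z" s]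
    by (simp add: Vraw_def Vtree_def split: endpt.splits)
  show ?thesis
  proof (rule catalan_functorI, goal_cases)
    case 1
    then show ?case by (intro category_prod category_catalan category_indisc)
  next
    case (2 x)
    then show ?case by (auto simp: prod_cat_def indisc_def o amap_Vfun eqv_cls[OF e])
  next
    case (3 f)
    then obtain a b c s t where "f = (cls a, cls b, cls c, s, t)" "typed a" "typed b" "typed c"
      by (auto simp: prod_cat_def elim!: Arr_catalanE)
    then show ?case
      by (auto simp: prod_cat_def indisc_def o amap_Vfun intro!: exI[of _ "V a b c s t"])
  next
    case (4 g f x' y')
    obtain a b c s t where f: "f = (cls a, cls b, cls c, s, t)" "typed a" "typed b" "typed c"
      using 4(2) by (auto simp: prod_cat_def elim!: Arr_catalanE)
    obtain a' b' c' t' u where g: "g = (cls a', cls b', cls c', t', u)" "typed a'" "typed b'" "typed c'"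
      using 4(1) by (auto simp: prod_cat_def elim!: Arr_catalanE)
    have m: "src a' = tgt a" "src b' = tgt b" "src c' = tgt c" "t' = t"
      using 4(3) f g by (auto simp: prod_cat_def indisc_def)
    have "V a' b' c' t u \<sim> y'" "V a b c s t \<sim> x'"
      using 4(4,5) f g m by (auto simp: amap_Vfun simp flip: cls_eq)
    then have "Comp (V a' b' c' t u) (V a b c s t) \<sim> Comp y' x'"
      using m by (auto intro: Comp_cong)
    moreover have "V (Comp a' a) (Comp b' b) (Comp c' c) s u \<sim> Comp (V a' b' c' t u) (V a b c s t)"
      using m f g by (auto intro: V_Comp)
    ultimately have "V (Comp a' a) (Comp b' b) (Comp c' c) s u \<sim> Comp y' x'"
      by (rule eqv_trans[rotated])
    then show ?case
      using f g m by (simp add: prod_cat_def indisc_def Cmp_catalan amap_Vfun eqv_cls)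
  qed
qed

lemma is_functor_V: "is_functor (Vsum indisc n) (catalan n) (copair (\<lambda>_. Vfun))"
  unfolding Vsum_def
  by (rule functor_copair) (auto simp: triples_def category_catalan intro: Vfun)

lemma is_functor_inclusion: "is_functor (Vsum disc n) (Vsum indisc n) id_functor"
    unfolding is_functor_def
    by (auto simp: category_Vsum category_indisc)
      (auto simp: sum_simps disc_def indisc_def id_functor_def)

lemma Usum_ArrE:
  assumes "q \<in> Arr (Usum n)"
  obtains a b where "q = ((arity a, arity b), cls a, cls b)" "typed a" "typed b" "arity a + arity b = n"
proof -
  obtain i j f g where q: "q = ((i, j), f, g)" by (cases q) auto
  with assms have "f \<in> Arr (catalan i)" "g \<in> Arr (catalan j)" "i + j = n"
    by (auto simp: sum_simps)
  then show thesis using that q by (metis Arr_catalanE)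
qed

lemma Vsum_ArrE:
  assumes "q \<in> Arr (Vsum J n)"
  obtains a b c s t where "q = ((arity a, arity b, arity c), cls a, cls b, cls c, s, t)"
    "typed a" "typed b" "typed c" "arity a + arity b + arity c = n" "(s, t) \<in> Arr J"
proof -
  obtain i j k f g h s t where q: "q = ((i, j, k), f, g, h, s, t)"
    by (metis surj_pair)
  with assms have *: "f \<in> Arr (catalan i)" "g \<in> Arr (catalan j)" "h \<in> Arr (catalan k)"
    "i + j + k = n" "(s, t) \<in> Arr J"
    by (auto simp: sum_simps)
  obtain a where "f = cls a" "typed a" "arity a = i" by (rule Arr_catalanE[OF *(1)])
  moreover obtain b where "g = cls b" "typed b" "arity b = j" by (rule Arr_catalanE[OF *(2)])
  moreover obtain c where "h = cls c" "typed c" "arity c = k" by (rule Arr_catalanE[OF *(3)])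
  ultimately show thesis using that q * by blast
qed

lemma Usum_Obj: "q \<in> Obj (Usum n) \<longleftrightarrow> (\<exists>x y. q = ((leaves x, leaves y), x, y) \<and> leaves x + leaves y = n)"
  using leaves_pos by (cases q) (auto simp: sum_simps simp del: One_nat_def)

lemma Vsum_Obj: "q \<in> Obj (Vsum J n) \<longleftrightarrow> (\<exists>x y z s. q = ((leaves x, leaves y, leaves z), x, y, z, s) \<and>
    leaves x + leaves y + leaves z = n \<and> s \<in> Obj J)"
  using leaves_pos by (cases q) (auto simp: sum_simps simp del: One_nat_def)

lemma is_functorD:
  assumes "is_functor C D F"
  shows "x \<in> Obj C \<Longrightarrow> omap F x \<in> Obj D" "x \<in> Obj C \<Longrightarrow> amap F (Idn C x) = Idn D (omap F x)"
    "f \<in> Arr C \<Longrightarrow> amap F f \<in> Arr D"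
    "f \<in> Arr C \<Longrightarrow> Dom D (amap F f) = omap F (Dom C f)"
    "f \<in> Arr C \<Longrightarrow> Cod D (amap F f) = omap F (Cod C f)"
    "g \<in> Arr C \<Longrightarrow> f \<in> Arr C \<Longrightarrow> Dom C g = Cod C f \<Longrightarrow>
       amap F (Cmp C g f) = Cmp D (amap F g) (amap F f)"
  using assms unfolding is_functor_def by auto

lemma Usum_Arr: "typed a \<Longrightarrow> typed b \<Longrightarrow> arity a + arity b = n \<Longrightarrow>
    ((arity a, arity b), cls a, cls b) \<in> Arr (Usum n)"
  by (auto simp: Usum_def coprod_cat_def prod_cat_def pairs_def cls_Arr leaves_pos simp del: One_nat_def)

lemma Vsum_Arr: "typed a \<Longrightarrow> typed b \<Longrightarrow> typed c \<Longrightarrow> arity a + arity b + arity c = n \<Longrightarrow>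
    (s, t) \<in> Arr J \<Longrightarrow> ((arity a, arity b, arity c), cls a, cls b, cls c, s, t) \<in> Arr (Vsum J n)"
  by (auto simp: Vsum_def coprod_cat_def prod_cat_def triples_def cls_Arr leaves_pos simp del: One_nat_def)

lemma Usum_ops:
  "Dom (Usum n) ((i, j), f, g) = ((i, j), Dom (catalan i) f, Dom (catalan j) g)"
  "Cod (Usum n) ((i, j), f, g) = ((i, j), Cod (catalan i) f, Cod (catalan j) g)"
  "Idn (Usum n) ((i, j), x, y) = ((i, j), cls (ident x), cls (ident y))"
  "Cmp (Usum n) ((i, j), f', g') ((i, j), f, g) = ((i, j), Cmp (catalan i) f' f, Cmp (catalan j) g' g)"
  by (simp_all add: sum_simps)

lemma Vsum_ops:
  "Dom (Vsum J n) ((i, j, k), f, g, h, r) =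
     ((i, j, k), Dom (catalan i) f, Dom (catalan j) g, Dom (catalan k) h, Dom J r)"
  "Cod (Vsum J n) ((i, j, k), f, g, h, r) =
     ((i, j, k), Cod (catalan i) f, Cod (catalan j) g, Cod (catalan k) h, Cod J r)"
  "Idn (Vsum J n) ((i, j, k), x, y, z, p) =
     ((i, j, k), cls (ident x), cls (ident y), cls (ident z), Idn J p)"
  "Cmp (Vsum J n) ((i, j, k), f', g', h', r') ((i, j, k), f, g, h, r) =
     ((i, j, k), Cmp (catalan i) f' f, Cmp (catalan j) g' g, Cmp (catalan k) h' h, Cmp J r' r)"
  by (simp_all add: sum_simps)

lemma endpt_simps:
  "Dom indisc (s, t) = s" "Cod indisc (s, t) = t" "Idn indisc s = (s, s)"
  "Cmp indisc (t', u) (s, t) = (s, u)" "Obj indisc = UNIV" "Arr indisc = UNIV"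
  "Dom disc (s, t) = s" "Cod disc (s, t) = t" "Idn disc s = (s, s)"
  "Cmp disc (t', u) (s, t) = (s, u)" "Obj disc = UNIV" "(s, t) \<in> Arr disc \<longleftrightarrow> s = t"
  by (auto simp: indisc_def disc_def)

lemma is_functor_W: "is_functor (Vsum disc n) (Usum n) (copair Wfun)"
proof -
  have o: "omap Ufun = (\<lambda>(x, y). Node x y)" by (simp add: Ufun_def)
  have Wo: "omap (copair Wfun) ((i, j, k), x, y, z, s) = (case s of
        Zero \<Rightarrow> ((i, j + k), x, Node y z) | One \<Rightarrow> ((i + j, k), Node x y, z))" for i j k x y z s
    by (simp add: copair_def Wfun_def o split: endpt.splits)
  have Wa: "amap (copair Wfun) ((i, j, k), f, g, h, s, t) = (case s of
        Zero \<Rightarrow> ((i, j + k), f, amap Ufun (g, h)) | One \<Rightarrow> ((i + j, k), amap Ufun (f, g), h))"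
    for i j k f g h s t
    by (simp add: copair_def Wfun_def split: endpt.splits)
  have 1: "omap (copair Wfun) q \<in> Obj (Usum n) \<and>
      amap (copair Wfun) (Idn (Vsum disc n) q) = Idn (Usum n) (omap (copair Wfun) q)"
    if q: "q \<in> Obj (Vsum disc n)" for q
  proof -
    obtain x y z s where "q = ((leaves x, leaves y, leaves z), x, y, z, s)"
      "leaves x + leaves y + leaves z = n"
      using q by (auto simp: Vsum_Obj)
    then show ?thesis
      by (cases s) (auto simp: Wo Wa Usum_Obj Usum_ops Vsum_ops endpt_simps amap_Ufun)
  qed
  have 2: "amap (copair Wfun) q \<in> Arr (Usum n) \<and>
      Dom (Usum n) (amap (copair Wfun) q) = omap (copair Wfun) (Dom (Vsum disc n) q) \<and>
      Cod (Usum n) (amap (copair Wfun) q) = omap (copair Wfun) (Cod (Vsum disc n) q)"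
    if q: "q \<in> Arr (Vsum disc n)" for q
  proof -
    obtain a b c s t where q: "q = ((arity a, arity b, arity c), cls a, cls b, cls c, s, t)"
      and t: "typed a" "typed b" "typed c" "arity a + arity b + arity c = n" "(s, t) \<in> Arr disc"
      by (rule Vsum_ArrE[OF q])
    show ?thesis using q t Usum_Arr[of a "U b c" n] Usum_Arr[of "U a b" c n]
      by (cases s) (auto simp: Wo Wa Usum_ops Vsum_ops endpt_simps amap_Ufun)
  qed
  have 3: "amap (copair Wfun) (Cmp (Vsum disc n) q' q) =
      Cmp (Usum n) (amap (copair Wfun) q') (amap (copair Wfun) q)"
    if q': "q' \<in> Arr (Vsum disc n)" and q: "q \<in> Arr (Vsum disc n)"
      and d: "Dom (Vsum disc n) q' = Cod (Vsum disc n) q" for q q'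
  proof -
    obtain a b c s t where q: "q = ((arity a, arity b, arity c), cls a, cls b, cls c, s, t)"
      and t: "typed a" "typed b" "typed c" "arity a + arity b + arity c = n" "(s, t) \<in> Arr disc"
      by (rule Vsum_ArrE[OF q])
    obtain a' b' c' s' t' where q': "q' = ((arity a', arity b', arity c'), cls a', cls b', cls c', s', t')"
      and t': "typed a'" "typed b'" "typed c'" "arity a' + arity b' + arity c' = n" "(s', t') \<in> Arr disc"
      by (rule Vsum_ArrE[OF q'])
    have m: "src a' = tgt a" "src b' = tgt b" "src c' = tgt c" "s' = s" "t' = s" "t = s"
      using d q q' t t' by (auto simp: Vsum_ops endpt_simps)
    then have "U (Comp b' b) (Comp c' c) \<sim> Comp (U b' c') (U b c)"
      "U (Comp a' a) (Comp b' b) \<sim> Comp (U a' b') (U a b)"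
      using t t' by (auto intro: U_Comp)
    then show ?thesis using q q' t t' m
      by (cases s) (simp_all add: Wa Usum_ops Vsum_ops endpt_simps amap_Ufun leaves_tgt Cmp_catalan eqv_cls)
  qed
  show ?thesis
    unfolding is_functor_def using 1 2 3 by (simp add: category_Vsum category_indisc category_Usum)
qed

lemma catalan_square_commutes:
  "functor_eq (Vsum disc n) (comp_functor (copair (\<lambda>_. Vfun)) id_functor)
     (comp_functor (copair (\<lambda>_. Ufun)) (copair Wfun))"
proof -
  have o: "omap Ufun = (\<lambda>(x, y). Node x y)" "omap Vfun = (\<lambda>(x, y, z, s). Vtree x y z s)"
    by (simp_all add: Ufun_def Vfun_def)
  have "amap (copair (\<lambda>_. Vfun)) q = amap (copair (\<lambda>_. Ufun)) (amap (copair Wfun) q)"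
    if q0: "q \<in> Arr (Vsum disc n)" for q
  proof -
    obtain a b c s t where q: "q = ((arity a, arity b, arity c), cls a, cls b, cls c, s, t)"
      and t: "typed a" "typed b" "typed c" "(s, t) \<in> Arr disc"
      by (rule Vsum_ArrE[OF q0])
    have "cls (V a b c s s) = cls (Vraw a b c s)" using t by (simp add: eqv_cls[OF V_end])
    then show ?thesis using q t
      by (cases s) (simp_all add: endpt_simps copair_def Wfun_def amap_Ufun amap_Vfun Vraw_def)
  qed
  moreover have "omap (copair (\<lambda>_. Vfun)) q = omap (copair (\<lambda>_. Ufun)) (omap (copair Wfun) q)" for q
    by (cases q) (auto simp: o copair_def Wfun_def Vtree_def split: endpt.splits)
  ultimately show ?thesis
    by (simp add: functor_eq_def comp_functor_def id_functor_def)
qed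

primrec lift_tree :: "((nat \<times> nat) \<times> tree \<times> tree, (nat \<times> nat) \<times> raw set \<times> raw set, 'o, 'a) fctr
    \<Rightarrow> tree \<Rightarrow> 'o" where
  "lift_tree G Leaf = undefined"
| "lift_tree G (Node x y) = omap G ((leaves x, leaves y), x, y)"

primrec lift_raw :: "('o, 'a) cat
    \<Rightarrow> ((nat \<times> nat \<times> nat) \<times> tree \<times> tree \<times> tree \<times> endpt,
     (nat \<times> nat \<times> nat) \<times> raw set \<times> raw set \<times> raw set \<times> endpt \<times> endpt, 'o, 'a) fctr
    \<Rightarrow> ((nat \<times> nat) \<times> tree \<times> tree, (nat \<times> nat) \<times> raw set \<times> raw set, 'o, 'a) fctr
    \<Rightarrow> raw \<Rightarrow> 'a" where
  "lift_raw X F G Star = undefined"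
| "lift_raw X F G (U a b) = amap G ((arity a, arity b), cls a, cls b)"
| "lift_raw X F G (V a b c s t) = amap F ((arity a, arity b, arity c), cls a, cls b, cls c, s, t)"
| "lift_raw X F G (Comp b a) = Cmp X (lift_raw X F G b) (lift_raw X F G a)"

lemma arity_eqv: "a \<sim> b \<Longrightarrow> arity a = arity b"
  using eqv_wf by auto

lemma catalan_pushout:
  fixes X :: "('o, 'a) cat" 
  assumes F: "is_functor (Vsum indisc n) X F" and G: "is_functor (Usum n) X G" and n: "2 \<le> n"
    and FG: "functor_eq (Vsum disc n) (comp_functor F id_functor) (comp_functor G (copair Wfun))"
  shows "\<exists>H. is_functor (catalan n) X H \<and>
      functor_eq (Vsum indisc n) (comp_functor H (copair (\<lambda>_. Vfun))) F \<and>
      functor_eq (Usum n) (comp_functor H (copair (\<lambda>_. Ufun))) G \<and>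
      (\<forall>H'. is_functor (catalan n) X H' \<longrightarrow>
        functor_eq (Vsum indisc n) (comp_functor H' (copair (\<lambda>_. Vfun))) F \<longrightarrow>
        functor_eq (Usum n) (comp_functor H' (copair (\<lambda>_. Ufun))) G \<longrightarrow>
        functor_eq (catalan n) H H')"
proof -
  let ?o = "lift_tree G" and ?h = "lift_raw X F G"
  have X: "category X" using F by (simp add: is_functor_def)
  have Fo: "omap F ((leaves x, leaves y, leaves z), x, y, z, s) = ?o (Vtree x y z s)"
    if "leaves x + leaves y + leaves z = n" for x y z s
  proof -
    have "((leaves x, leaves y, leaves z), x, y, z, s) \<in> Obj (Vsum disc n)"
      using that by (auto simp: sum_simps disc_def indisc_def leaves_pos simp del: One_nat_def)
    then show ?thesis
      using FG by (cases s)
        (auto simp: functor_eq_def comp_functor_def id_functor_def copair_def Wfun_def Ufun_def Vtree_def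
          dest!: bspec)
  qed
  have Fe: "amap F ((arity a, arity b, arity c), cls a, cls b, cls c, s, s) = ?h (Vraw a b c s)"
    if "typed a" "typed b" "typed c" "arity a + arity b + arity c = n" for a b c s
  proof -
    have "((arity a, arity b, arity c), cls a, cls b, cls c, s, s) \<in> Arr (Vsum disc n)"
      using that by (intro Vsum_Arr) (auto simp: disc_def)
    then show ?thesis
      using FG that by (cases s)
        (auto simp: functor_eq_def comp_functor_def id_functor_def copair_def Wfun_def amap_Ufun Vraw_def
          dest!: bspec)
  qed
  have h: "typed a \<Longrightarrow> arity a = n \<Longrightarrow> ?h a \<in> Arr X \<and> Dom X (?h a) = ?o (src a) \<and> Cod X (?h a) = ?o (tgt a)" for a
  proof (induction a)
    case Star
    then show ?case using n by simp
  next
    case (U a b)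
    then have "((arity a, arity b), cls a, cls b) \<in> Arr (Usum n)" by (intro Usum_Arr) auto
    then show ?case using U.prems is_functorD[OF G] by (simp add: Usum_ops leaves_tgt)
  next
    case (V a b c s t)
    then have "((arity a, arity b, arity c), cls a, cls b, cls c, s, t) \<in> Arr (Vsum indisc n)"
      by (intro Vsum_Arr) (auto simp: indisc_def)
    then show ?case using V.prems is_functorD[OF F] by (simp add: Vsum_ops endpt_simps leaves_tgt flip: Fo)
  next
    case (Comp b a)
    then show ?case using X by (simp add: category_def leaves_tgt)
  qed
  have hid: "?h (ident x) = Idn X (?o x)" if "leaves x = n" for x
  proof (cases x)
    case Leaf
    then show ?thesis using that n by simp
  next
    case (Node y z)
    then have "((leaves y, leaves z), y, z) \<in> Obj (Usum n)"
      using that by (auto simp: sum_simps leaves_pos simp del: One_nat_def)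
    from is_functorD(2)[OF G this] show ?thesis using Node by (simp add: Usum_ops)
  qed
  have hh: "a \<sim> b \<Longrightarrow> arity a = n \<Longrightarrow> ?h a = ?h b" for a b
  proof (induction rule: eqv.induct)
    case (eqv_sym a b)
    then show ?case by (simp add: arity_eqv)
  next
    case (eqv_trans a b c)
    then show ?case by (simp add: arity_eqv)
  next
    case (U_cong a a' b b')
    then show ?case by (simp add: arity_eqv eqv_cls)
  next
    case (V_cong a a' b b' c c' s t)
    then show ?case by (simp add: arity_eqv eqv_cls)
  next
    case (Comp_cong a a' b b')
    then show ?case using eqv_wf[OF Comp_cong(2)] leaves_tgt by simp
  next
    case (eqv_assoc a b c)
    then show ?case using X h by (simp add: category_def leaves_tgt)
  next
    case (id_left a)
    then have "arity a = n" by (simp add: leaves_tgt)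
    moreover from this have "Cmp X (Idn X (Cod X (?h a))) (?h a) = ?h a"
      using id_left h[of a] category_id(1)[OF X] by blast
    ultimately show ?case using id_left h[of a] hid[of "tgt a"] by (simp add: leaves_tgt)
  next
    case (id_right a)
    then have "arity a = n" by (simp add: leaves_tgt)
    moreover from this have "Cmp X (?h a) (Idn X (Dom X (?h a))) = ?h a"
      using id_right h[of a] category_id(2)[OF X] by blast
    ultimately show ?case using id_right h[of a] hid[of "src a"] by (simp add: leaves_tgt)
  next
    case (U_Comp a' a b' b)
    then have "((arity a, arity b), cls a, cls b) \<in> Arr (Usum n)"
      "((arity a, arity b), cls a', cls b') \<in> Arr (Usum n)"
      using Usum_Arr[of a b] Usum_Arr[of a' b'] by (auto simp: leaves_tgt)
    from is_functorD(6)[OF G this(2,1)] show ?case using U_Comp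
      by (simp add: Usum_ops leaves_tgt Cmp_catalan)
  next
    case (V_Comp a' a b' b c' c s u t)
    then have "((arity a, arity b, arity c), cls a, cls b, cls c, s, t) \<in> Arr (Vsum indisc n)"
      "((arity a, arity b, arity c), cls a', cls b', cls c', t, u) \<in> Arr (Vsum indisc n)"
      using Vsum_Arr[of a b c _ _ _ indisc] Vsum_Arr[of a' b' c' _ _ _ indisc]
      by (auto simp: leaves_tgt indisc_def)
    from is_functorD(6)[OF F this(2,1)] show ?case using V_Comp
      by (simp add: Vsum_ops endpt_simps leaves_tgt Cmp_catalan)
  next
    case (V_end a b c s)
    then show ?case using Fe by simp
  qed simp
  define H where "H = \<lparr>omap = ?o, amap = (\<lambda>f. ?h (rep f))\<rparr>"
  have o: "omap H = ?o" and m: "typed a \<Longrightarrow> arity a = n \<Longrightarrow> amap H (cls a) = ?h a" for a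
    using hh[OF rep_eqv] by (simp_all add: H_def)
  have oX: "?o x \<in> Obj X" if "leaves x = n" for x
    using h[of "ident x"] that X by (auto simp: category_def)
  have mh: "amap H f \<in> Arr X \<and> Dom X (amap H f) = omap H (Dom (catalan n) f) \<and>
      Cod X (amap H f) = omap H (Cod (catalan n) f)" if f: "f \<in> Arr (catalan n)" for f
    by (rule Arr_catalanE[OF f]) (simp add: h m o)
  have mc: "amap H (Cmp (catalan n) g f) = Cmp X (amap H g) (amap H f)"
    if gf: "g \<in> Arr (catalan n)" "f \<in> Arr (catalan n)" "Dom (catalan n) g = Cod (catalan n) f" for g f
  proof -
    obtain b where b: "g = cls b" "typed b" "arity b = n" by (rule Arr_catalanE[OF gf(1)])
    obtain a where a: "f = cls a" "typed a" "arity a = n" by (rule Arr_catalanE[OF gf(2)])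
    show ?thesis using a b gf(3) by (simp add: Cmp_catalan m)
  qed
  have "is_functor (catalan n) X H"
    unfolding is_functor_def using X category_catalan mh mc by (simp add: o m oX hid)
  moreover have "functor_eq (Vsum indisc n) (comp_functor H (copair (\<lambda>_. Vfun))) F"
    unfolding functor_eq_def comp_functor_def
    by (auto simp: Vsum_Obj o Fo copair_def Vfun_def)
      (auto elim!: Vsum_ArrE simp: m amap_Vfun simp flip: Vfun_def)
  moreover have "functor_eq (Usum n) (comp_functor H (copair (\<lambda>_. Ufun))) G"
    unfolding functor_eq_def comp_functor_def
    by (auto simp: Usum_Obj o copair_def) (auto simp: Ufun_def elim!: Usum_ArrE simp: m amap_Ufun)
  moreover have "functor_eq (catalan n) H H'"
    if H': "is_functor (catalan n) X H'"
      and V': "functor_eq (Vsum indisc n) (comp_functor H' (copair (\<lambda>_. Vfun))) F"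
      and U': "functor_eq (Usum n) (comp_functor H' (copair (\<lambda>_. Ufun))) G" for H'
  proof -
    have "omap H' x = ?o x" if "leaves x = n" for x
    proof (cases x)
      case Leaf
      then show ?thesis using that n by simp
    next
      case (Node y z)
      then have "((leaves y, leaves z), y, z) \<in> Obj (Usum n)" using that by (auto simp: Usum_Obj)
      with U' show ?thesis using Node
        by (auto simp: functor_eq_def comp_functor_def copair_def Ufun_def dest!: bspec)
    qed
    moreover have "typed a \<Longrightarrow> arity a = n \<Longrightarrow> amap H' (cls a) = ?h a" for a
    proof (induction a)
      case Star
      then show ?case using n by simp
    next
      case (U a b)
      then have "((arity a, arity b), cls a, cls b) \<in> Arr (Usum n)" by (intro Usum_Arr) auto
      with U' show ?case using U.prems
        by (auto simp: functor_eq_def comp_functor_def copair_def amap_Ufun dest!: bspec)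
    next
      case (V a b c s t)
      then have "((arity a, arity b, arity c), cls a, cls b, cls c, s, t) \<in> Arr (Vsum indisc n)"
        by (intro Vsum_Arr) (auto simp: indisc_def)
      with V' show ?case using V.prems
        by (auto simp: functor_eq_def comp_functor_def copair_def amap_Vfun dest!: bspec)
    next
      case (Comp b a)
      then have "amap H' (Cmp (catalan n) (cls b) (cls a)) = Cmp X (amap H' (cls b)) (amap H' (cls a))"
        by (intro is_functorD(6)[OF H'] cls_Arr) (auto simp: leaves_tgt)
      then show ?case using Comp by (simp add: Cmp_catalan leaves_tgt)
    qed
    ultimately show ?thesis
      unfolding functor_eq_def by (auto simp: o m elim!: Arr_catalanE)
  qed
  ultimately show ?thesis by blast
qed


section \<open>The composition functors\<close>

text \<open>
  An order-preserving surjection \<open>\<pi> : {1..t} \<rightarrow> {1..n}\<close> is determined by its fibre sizes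
  \<open>m\<^sub>1, \<dots>, m\<^sub>n\<close>, an arbitrary list of \<open>n\<close> positive numbers with sum \<open>t\<close>; substitution depends on
  them only through the numbers of leaves.  On a formal composite, functoriality is used in
  the form \<open>Q(\<psi> \<circ> \<phi>, \<gamma>) = Q(\<psi>, \<gamma>) \<circ> Q(\<phi>, id)\<close>.  The resulting recursion on actual
  arrows is recorded in \<open>catalan_Q_1\<close>, \<open>catalan_Q_U\<close> and \<open>catalan_Q_V\<close> below.
\<close>

primrec subst_tree :: "tree \<Rightarrow> tree list \<Rightarrow> tree" where
  "subst_tree Leaf gs = hd gs"
| "subst_tree (Node x y) gs =
     Node (subst_tree x (take (leaves x) gs)) (subst_tree y (drop (leaves x) gs))"

primrec subst_raw :: "raw \<Rightarrow> raw list \<Rightarrow> raw" where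
  "subst_raw Star cs = hd cs"
| "subst_raw (U a b) cs =
     U (subst_raw a (take (arity a) cs)) (subst_raw b (drop (arity a) cs))"
| "subst_raw (V a b c s t) cs =
     V (subst_raw a (take (arity a) cs))
       (subst_raw b (take (arity b) (drop (arity a) cs)))
       (subst_raw c (drop (arity a + arity b) cs)) s t"
| "subst_raw (Comp b a) cs = Comp (subst_raw b cs) (subst_raw a (map (\<lambda>c. ident (src c)) cs))"

definition catalan_Q :: "nat list \<Rightarrow> (tree \<times> tree list, raw set \<times> raw set list, tree, raw set) fctr" where
  "catalan_Q ms = \<lparr>omap = (\<lambda>(x, gs). subst_tree x gs),
     amap = (\<lambda>(f, gs). cls (subst_raw (rep f) (map rep gs)))\<rparr>"


definition typed_list :: "raw list \<Rightarrow> nat \<Rightarrow> bool" where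
  "typed_list cs n \<longleftrightarrow> length cs = n \<and> (\<forall>c\<in>set cs. typed c)"

lemma typed_list_parts:
  "typed_list cs (m + n) \<Longrightarrow> typed_list (take m cs) m"
  "typed_list cs (m + n) \<Longrightarrow> typed_list (drop m cs) n"
  "typed_list cs (m + n + k) \<Longrightarrow> typed_list (take m cs) m"
  "typed_list cs (m + n + k) \<Longrightarrow> typed_list (take n (drop m cs)) n"
  "typed_list cs (m + n + k) \<Longrightarrow> typed_list (drop (m + n) cs) k"
  by (auto simp: typed_list_def dest!: in_set_takeD in_set_dropD)

abbreviation ids :: "raw list \<Rightarrow> raw list" where
  "ids cs \<equiv> map (\<lambda>c. ident (src c)) cs"

lemma subst_Vtree: "subst_tree (Vtree x y z s) gs = Vtree (subst_tree x (take (leaves x) gs))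
    (subst_tree y (take (leaves y) (drop (leaves x) gs)))
    (subst_tree z (drop (leaves x + leaves y) gs)) s"
  by (cases s) (simp_all add: Vtree_def take_drop drop_drop add.commute)

lemma typed_list_ids: "typed_list cs n \<Longrightarrow> typed_list (ids cs) n"
  by (auto simp: typed_list_def)

lemma subst_typed:
  assumes "typed a" "typed_list cs (arity a)"
  shows "typed (subst_raw a cs) \<and> src (subst_raw a cs) = subst_tree (src a) (map src cs) \<and>
    tgt (subst_raw a cs) = subst_tree (tgt a) (map tgt cs)"
  using assms
proof (induction a arbitrary: cs)
  case Star
  then show ?case by (cases cs) (auto simp: typed_list_def)
next
  case (U a b)
  then have "typed_list cs (arity a + arity b)" by simp
  note t = typed_list_parts(1,2)[OF this]
  show ?case using U.IH(1)[OF _ t(1)] U.IH(2)[OF _ t(2)] U.prems(1)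
    by (simp add: take_map drop_map leaves_tgt)
next
  case (V a b c s t)
  then have "typed_list cs (arity a + arity b + arity c)" by simp
  note t = typed_list_parts(3-5)[OF this]
  show ?case using V.IH(1)[OF _ t(1)] V.IH(2)[OF _ t(2)] V.IH(3)[OF _ t(3)] V.prems(1)
    by (simp add: take_map drop_map leaves_tgt subst_Vtree)
next
  case (Comp b a)
  then have "arity b = arity a" by (simp add: leaves_tgt)
  with Comp show ?case
    using Comp.IH(1)[of cs] Comp.IH(2)[of "ids cs"] by (simp add: comp_def typed_list_ids)
qed

lemma subst_ident:
  "length gs = leaves x \<Longrightarrow> subst_raw (ident x) (map ident gs) = ident (subst_tree x gs)"
proof (induction x arbitrary: gs)
  case Leaf
  then show ?case by (cases gs) auto
qed (simp add: take_map drop_map)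

lemma subst_cong_args:
  assumes "typed a" "typed_list cs (arity a)" "list_all2 (\<sim>) cs ds"
  shows "subst_raw a cs \<sim> subst_raw a ds"
  using assms
proof (induction a arbitrary: cs ds)
  case Star
  then show ?case by (cases cs; cases ds) (auto simp: typed_list_def)
next
  case (U a b)
  then have "typed_list cs (arity a + arity b)" by simp
  note t = typed_list_parts(1,2)[OF this]
  show ?case using U t by (auto intro!: U_cong U.IH list_all2_takeI list_all2_dropI)
next
  case (V a b c s t)
  then have "typed_list cs (arity a + arity b + arity c)" by simp
  note t = typed_list_parts(3-5)[OF this]
  show ?case using V t by (auto intro!: V_cong V.IH list_all2_takeI list_all2_dropI)
next
  case (Comp b a)
  have ar: "arity b = arity a" using Comp.prems by (simp add: leaves_tgt)
  have i: "ids cs = ids ds"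
    using Comp.prems(3) by (induction rule: list_all2_induct) (auto dest: eqv_wf)
  have "subst_raw a (ids cs) \<sim> subst_raw a (ids cs)"
    using subst_typed[of a "ids cs"] Comp.prems by (intro eqv_refl) (simp add: typed_list_ids)
  moreover have "src (subst_raw b cs) = tgt (subst_raw a (ids cs))"
    using subst_typed[of b cs] subst_typed[of a "ids cs"] Comp.prems ar
    by (simp add: comp_def typed_list_ids)
  ultimately show ?case using Comp i by (auto intro!: Comp_cong simp: ar)
qed

lemma subst_refl: "typed a \<Longrightarrow> typed_list cs (arity a) \<Longrightarrow> subst_raw a cs \<sim> subst_raw a cs"
  using subst_typed eqv_refl by blast

abbreviation comps :: "raw list \<Rightarrow> raw list \<Rightarrow> raw list" where
  "comps ds cs \<equiv> map2 Comp ds cs"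

definition composable :: "raw list \<Rightarrow> raw list \<Rightarrow> nat \<Rightarrow> bool" where
  "composable ds cs n \<longleftrightarrow> typed_list ds n \<and> typed_list cs n \<and> map src ds = map tgt cs"

lemma composable_parts:
  "composable ds cs (m + n) \<Longrightarrow> composable (take m ds) (take m cs) m"
  "composable ds cs (m + n) \<Longrightarrow> composable (drop m ds) (drop m cs) n"
  "composable ds cs (m + n + k) \<Longrightarrow> composable (take m ds) (take m cs) m"
  "composable ds cs (m + n + k) \<Longrightarrow> composable (take n (drop m ds)) (take n (drop m cs)) n"
  "composable ds cs (m + n + k) \<Longrightarrow> composable (drop (m + n) ds) (drop (m + n) cs) k"
  by (auto simp: composable_def typed_list_parts simp flip: take_map drop_map)

lemma composable_comps:
  assumes "composable ds cs n"
  shows "typed_list (comps ds cs) n" "map src (comps ds cs) = map src cs"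
    "map tgt (comps ds cs) = map tgt ds"
proof -
  have l: "length ds = n" "length cs = n" and s: "\<And>i. i < n \<Longrightarrow> src (ds ! i) = tgt (cs ! i)"
    using assms by (auto simp: composable_def typed_list_def) (metis nth_map)
  show "typed_list (comps ds cs) n"
    using assms l s by (auto simp: composable_def typed_list_def set_zip dest: nth_mem)
  show "map src (comps ds cs) = map src cs" "map tgt (comps ds cs) = map tgt ds"
    using l by (auto intro!: nth_equalityI)
qed

lemma comps_ids:
  assumes "typed_list cs n"
  shows "list_all2 (\<sim>) (comps cs (ids cs)) cs" "list_all2 (\<sim>) (comps (map (\<lambda>c. ident (tgt c)) cs) cs) cs"
  using assms by (auto simp: list_all2_conv_all_nth typed_list_def intro: id_left id_right)

lemma take_comps: "take n (comps ds cs) = comps (take n ds) (take n cs)"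
  "drop n (comps ds cs) = comps (drop n ds) (drop n cs)"
  by (simp_all add: take_map drop_map take_zip drop_zip)

lemma subst_split:
  assumes "typed a" "composable ds cs (arity a)"
  shows "subst_raw a (comps ds cs) \<sim> Comp (subst_raw a ds) (subst_raw (ident (src a)) cs) \<and>
    subst_raw a (comps ds cs) \<sim> Comp (subst_raw (ident (tgt a)) ds) (subst_raw a cs)"
  using assms
proof (induction a arbitrary: ds cs)
  case Star
  then have "length ds = 1" "length cs = 1" "composable ds cs 1"
    by (auto simp: composable_def typed_list_def)
  then obtain d c where "ds = [d]" "cs = [c]" by (auto simp: length_Suc_conv)
  with Star show ?case by (auto intro!: eqv_refl simp: composable_def typed_list_def)
next
  case (U a b)
  then have c: "composable ds cs (arity a + arity b)" by simp
  note t = composable_parts(1,2)[OF this]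
  have a: "typed a" "typed b" using U.prems by auto
  note A = U.IH(1)[OF a(1) t(1)] note B = U.IH(2)[OF a(2) t(2)]
  have "U (subst_raw a (comps (take (arity a) ds) (take (arity a) cs)))
      (subst_raw b (comps (drop (arity a) ds) (drop (arity a) cs))) \<sim> Comp (U x x') (U y y')"
    if "subst_raw a (comps (take (arity a) ds) (take (arity a) cs)) \<sim> Comp x y"
      "subst_raw b (comps (drop (arity a) ds) (drop (arity a) cs)) \<sim> Comp x' y'" for x x' y y'
    using that by (intro eqv_trans[OF U_cong[OF that] U_Comp]) (auto dest: eqv_wf)
  with A B show ?case using a by (simp add: take_comps leaves_tgt)
next
  case (V a b c s t)
  then have c: "composable ds cs (arity a + arity b + arity c)" by simp
  note t = composable_parts(3-5)[OF this]
  have a: "typed a" "typed b" "typed c" using V.prems by auto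
  note A = V.IH(1)[OF a(1) t(1)] note B = V.IH(2)[OF a(2) t(2)] note C = V.IH(3)[OF a(3) t(3)]
  let ?a = "subst_raw a (comps (take (arity a) ds) (take (arity a) cs))"
  let ?b = "subst_raw b (comps (take (arity b) (drop (arity a) ds)) (take (arity b) (drop (arity a) cs)))"
  let ?c = "subst_raw c (comps (drop (arity a + arity b) ds) (drop (arity a + arity b) cs))"
  have 1: "V ?a ?b ?c s t \<sim> Comp (V x x' x'' u t) (V y y' y'' s u)"
    if "?a \<sim> Comp x y" "?b \<sim> Comp x' y'" "?c \<sim> Comp x'' y''" for x x' x'' y y' y'' u
    using that by (intro eqv_trans[OF V_cong[OF that] V_Comp]) (auto dest: eqv_wf)
  have vi: "subst_raw (ident (Vtree x y z u)) es =
      Vraw (subst_raw (ident x) (take (leaves x) es)) (subst_raw (ident y) (take (leaves y) (drop (leaves x) es)))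
        (subst_raw (ident z) (drop (leaves x + leaves y) es)) u" for x y z u es
    by (cases u) (simp_all add: Vtree_def Vraw_def take_drop drop_drop add.commute)
  have "V ?a ?b ?c s t \<sim> Comp (V x x' x'' s t) (Vraw y y' y'' s)"
    if "?a \<sim> Comp x y" "?b \<sim> Comp x' y'" "?c \<sim> Comp x'' y''" for x x' x'' y y' y''
    using that[THEN eqv_wf] by (intro eqv_trans[OF 1[OF that, of s]] Comp_cong) (auto intro: V_end eqv_refl)
  moreover have "V ?a ?b ?c s t \<sim> Comp (Vraw x x' x'' t) (V y y' y'' s t)"
    if "?a \<sim> Comp x y" "?b \<sim> Comp x' y'" "?c \<sim> Comp x'' y''" for x x' x'' y y' y''
    using that[THEN eqv_wf] by (intro eqv_trans[OF 1[OF that, of t]] Comp_cong) (auto intro: V_end eqv_refl)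
  ultimately show ?case using a A B C by (simp add: take_comps vi leaves_tgt)
next
  case (Comp b a)
  then have a: "typed b" "typed a" "src b = tgt a" and ar: "arity b = arity a"
    by (auto simp: leaves_tgt)
  from Comp.prems ar have c: "composable ds cs (arity a)" "composable ds cs (arity b)" by auto
  then have tl: "typed_list ds (arity a)" "typed_list cs (arity a)" and m: "map src ds = map tgt cs"
    by (auto simp: composable_def)
  have ci: "composable cs (ids cs) (arity a)" "composable (ids ds) cs (arity a)"
    using tl m by (auto simp: composable_def typed_list_ids comp_def)
  have i: "ids (comps ds cs) = ids cs"
    using composable_comps(2)[OF c(1)] by (metis (no_types, lifting) map_map comp_def map_eq_conv)
  have ids_eq: "ids ds = map (\<lambda>c. ident (tgt c)) cs" using arg_cong[OF m, of "map ident"]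
    by (simp add: comp_def)
  let ?idb = "\<lambda>es. subst_raw (ident (src b)) es"
  have B: "subst_raw b (comps ds cs) \<sim> Comp (subst_raw b ds) (?idb cs)"
    "subst_raw b (comps ds cs) \<sim> Comp (subst_raw (ident (tgt b)) ds) (subst_raw b cs)"
    using Comp.IH(1)[OF a(1) c(2)] by auto
  have A1: "Comp (?idb cs) (subst_raw a (ids cs)) \<sim> subst_raw a cs"
  proof -
    have "subst_raw a (comps cs (ids cs)) \<sim> Comp (?idb cs) (subst_raw a (ids cs))"
      using Comp.IH(2)[OF a(2) ci(1)] a(3) by simp
    moreover have "subst_raw a (comps cs (ids cs)) \<sim> subst_raw a cs"
      by (rule subst_cong_args[OF a(2) composable_comps(1)[OF ci(1)] comps_ids(1)[OF tl(2)]])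
    ultimately show ?thesis by (blast intro: eqv_trans eqv_sym)
  qed
  have A2: "Comp (subst_raw a (ids ds)) (subst_raw (ident (src a)) cs) \<sim> subst_raw a cs"
  proof -
    have "subst_raw a (comps (ids ds) cs) \<sim> Comp (subst_raw a (ids ds)) (subst_raw (ident (src a)) cs)"
      using Comp.IH(2)[OF a(2) ci(2)] by simp
    moreover have "subst_raw a (comps (ids ds) cs) \<sim> subst_raw a cs"
      using subst_cong_args[OF a(2) composable_comps(1)[OF ci(2)]] comps_ids(2)[OF tl(2)]
      by (simp add: ids_eq)
    ultimately show ?thesis by (blast intro: eqv_trans eqv_sym)
  qed
  have L: "subst_raw (Comp b a) (comps ds cs) = Comp (subst_raw b (comps ds cs)) (subst_raw a (ids cs))"
    using i by simp
  have T: "typed (subst_raw b ds)" "typed (?idb cs)" "typed (subst_raw a (ids cs))" "typed (subst_raw a (ids ds))"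
     "typed (subst_raw (ident (src a)) cs)" "typed (subst_raw (ident (tgt b)) ds)" "typed (subst_raw b cs)"
     "src (subst_raw b (comps ds cs)) = tgt (subst_raw a (ids cs))"
     "src (subst_raw b ds) = tgt (?idb cs)" "src (?idb cs) = tgt (subst_raw a (ids cs))"
     "src (subst_raw b ds) = tgt (subst_raw a (ids ds))"
     "src (subst_raw a (ids ds)) = tgt (subst_raw (ident (src a)) cs)"
     "src (subst_raw (ident (tgt b)) ds) = tgt (subst_raw b cs)"
     "src (subst_raw b cs) = tgt (subst_raw a (ids cs))"
    using a m ar tl composable_comps[OF c(1)] subst_typed[of b] subst_typed[of a] subst_typed[of "ident x" for x]
    by (simp_all add: leaves_tgt typed_list_ids comp_def)
  have "subst_raw (Comp b a) (comps ds cs) \<sim> Comp (Comp (subst_raw b ds) (?idb cs)) (subst_raw a (ids cs))"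
    unfolding L using T by (intro Comp_cong B eqv_refl)
  also have "\<dots> \<sim> Comp (subst_raw b ds) (Comp (?idb cs) (subst_raw a (ids cs)))"
    using T by (intro eqv_assoc) simp
  also have "\<dots> \<sim> Comp (subst_raw b ds) (Comp (subst_raw a (ids ds)) (subst_raw (ident (src a)) cs))"
    using T by (intro Comp_cong[OF eqv_refl eqv_trans[OF A1 eqv_sym[OF A2]]]) simp_all
  also have "\<dots> \<sim> Comp (Comp (subst_raw b ds) (subst_raw a (ids ds))) (subst_raw (ident (src a)) cs)"
    using T by (intro eqv_sym[OF eqv_assoc]) simp
  finally have 1: "subst_raw (Comp b a) (comps ds cs) \<sim>
      Comp (subst_raw (Comp b a) ds) (subst_raw (ident (src (Comp b a))) cs)" by simp
  have "subst_raw (Comp b a) (comps ds cs) \<sim>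
      Comp (Comp (subst_raw (ident (tgt b)) ds) (subst_raw b cs)) (subst_raw a (ids cs))"
    unfolding L using T by (intro Comp_cong B eqv_refl)
  also have "\<dots> \<sim> Comp (subst_raw (ident (tgt b)) ds) (Comp (subst_raw b cs) (subst_raw a (ids cs)))"
    using T by (intro eqv_assoc) simp
  finally show ?case using 1 by simp
qed

lemma subst_Comp:
  assumes "typed (Comp b a)" "composable ds cs (arity a)"
  shows "subst_raw (Comp b a) (comps ds cs) \<sim> Comp (subst_raw b ds) (subst_raw a cs)"
proof -
  have a: "typed b" "typed a" "src b = tgt a" and ar: "arity b = arity a"
    using assms(1) by (auto simp: leaves_tgt)
  have tl: "typed_list ds (arity a)" "typed_list cs (arity a)" and m: "map src ds = map tgt cs"
    using assms(2) by (auto simp: composable_def)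
  have ci: "composable cs (ids cs) (arity a)"
    using tl by (auto simp: composable_def typed_list_ids comp_def)
  have i: "ids (comps ds cs) = ids cs"
    using composable_comps(2)[OF assms(2)] by (metis (no_types, lifting) map_map comp_def map_eq_conv)
  let ?i = "\<lambda>es. subst_raw (ident (src b)) es"
  have A: "Comp (?i cs) (subst_raw a (ids cs)) \<sim> subst_raw a cs"
  proof -
    have "subst_raw a (comps cs (ids cs)) \<sim> Comp (?i cs) (subst_raw a (ids cs))"
      using subst_split[OF a(2) ci] a(3) by simp
    moreover have "subst_raw a (comps cs (ids cs)) \<sim> subst_raw a cs"
      by (rule subst_cong_args[OF a(2) composable_comps(1)[OF ci] comps_ids(1)[OF tl(2)]])
    ultimately show ?thesis by (blast intro: eqv_trans eqv_sym)
  qed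
  have T: "typed (subst_raw b ds)" "typed (?i cs)" "typed (subst_raw a (ids cs))"
     "src (subst_raw b (comps ds cs)) = tgt (subst_raw a (ids cs))"
     "src (subst_raw b ds) = tgt (?i cs)" "src (?i cs) = tgt (subst_raw a (ids cs))"
    using a m ar tl composable_comps[OF assms(2)] subst_typed[of b] subst_typed[of a] subst_typed[of "ident x" for x]
    by (simp_all add: leaves_tgt typed_list_ids comp_def)
  have "subst_raw (Comp b a) (comps ds cs) \<sim> Comp (Comp (subst_raw b ds) (?i cs)) (subst_raw a (ids cs))"
    using T subst_split[of b ds cs] a(1) assms(2) ar i by (auto intro!: Comp_cong eqv_refl)
  also have "\<dots> \<sim> Comp (subst_raw b ds) (Comp (?i cs) (subst_raw a (ids cs)))"
    using T by (intro eqv_assoc) simp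
  also have "\<dots> \<sim> Comp (subst_raw b ds) (subst_raw a cs)"
    using T by (intro Comp_cong eqv_refl A) auto
  finally show ?thesis .
qed

lemma subst_eqv: "a \<sim> b \<Longrightarrow> typed_list cs (arity a) \<Longrightarrow> subst_raw a cs \<sim> subst_raw b cs"
proof (induction arbitrary: cs rule: eqv.induct)
  case (eqv_refl a)
  then show ?case by (intro subst_refl)
next
  case (eqv_sym a b)
  then show ?case using arity_eqv eqv.eqv_sym by metis
next
  case (eqv_trans a b c)
  then show ?case using arity_eqv eqv.eqv_trans by metis
next
  case (U_cong a a' b b')
  then have "typed_list cs (arity a + arity b)" by simp
  note t = typed_list_parts(1,2)[OF this]
  show ?case using U_cong.IH(1)[OF t(1)] U_cong.IH(2)[OF t(2)] arity_eqv[OF U_cong.hyps(1)]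
    by (simp add: eqv.U_cong)
next
  case (V_cong a a' b b' c c' s t)
  then have "typed_list cs (arity a + arity b + arity c)" by simp
  note t = typed_list_parts(3-5)[OF this]
  show ?case using V_cong.IH(1)[OF t(1)] V_cong.IH(2)[OF t(2)] V_cong.IH(3)[OF t(3)]
      arity_eqv[OF V_cong.hyps(1)] arity_eqv[OF V_cong.hyps(2)]
    by (simp add: eqv.V_cong)
next
  case (Comp_cong a a' b b')
  have ar: "arity a = arity b" and ty: "typed a" "typed b"
    using Comp_cong.hyps eqv_wf by (auto simp: leaves_tgt)
  have t: "typed_list (ids cs) (arity b)" "typed_list cs (arity a)" "typed_list cs (arity b)"
    using Comp_cong.prems ar by (auto simp: typed_list_ids)
  have "src (subst_raw a cs) = tgt (subst_raw b (ids cs))"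
    using subst_typed[OF ty(1) t(2)] subst_typed[OF ty(2) t(1)] Comp_cong.hyps(3) by (simp add: comp_def)
  then show ?case using Comp_cong.IH(1)[OF t(2)] Comp_cong.IH(2)[OF t(1)]
    by (simp add: eqv.Comp_cong)
next
  case (eqv_assoc a b c)
  have "typed (subst_raw (Comp (Comp a b) c) cs)"
    using eqv_assoc subst_typed by blast
  then show ?case by (simp add: eqv.eqv_assoc comp_def)
next
  case (id_left a)
  have t: "typed_list cs (arity a)" using id_left by (simp add: leaves_tgt)
  have cc: "composable cs (ids cs) (arity a)"
    using t by (auto simp: composable_def typed_list_ids comp_def)
  have "subst_raw (Comp (ident (tgt a)) a) cs \<sim> subst_raw a (comps cs (ids cs))"
    using subst_split[OF id_left(1) cc] by (auto intro: eqv_sym)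
  also have "\<dots> \<sim> subst_raw a cs"
    by (rule subst_cong_args[OF id_left(1) composable_comps(1)[OF cc] comps_ids(1)[OF t]])
  finally show ?case .
next
  case (id_right a)
  have t: "typed_list cs (arity a)" using id_right by simp
  have cc: "composable cs (ids cs) (arity a)"
    using t by (auto simp: composable_def typed_list_ids comp_def)
  have "subst_raw (Comp a (ident (src a))) cs \<sim> subst_raw a (comps cs (ids cs))"
    using subst_split[OF id_right(1) cc] by (auto intro: eqv_sym)
  also have "\<dots> \<sim> subst_raw a cs"
    by (rule subst_cong_args[OF id_right(1) composable_comps(1)[OF cc] comps_ids(1)[OF t]])
  finally show ?case .
next
  case (U_Comp a' a b' b)
  have ar: "arity a' = arity a" "arity b' = arity b" using U_Comp.hyps by (auto simp: leaves_tgt)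
  have "typed (subst_raw (U (Comp a' a) (Comp b' b)) cs)"
    using U_Comp subst_typed[of "U (Comp a' a) (Comp b' b)"] by simp
  then show ?case using ar by (simp add: eqv.U_Comp take_map drop_map)
next
  case (V_Comp a' a b' b c' c s u t)
  have ar: "arity a' = arity a" "arity b' = arity b" "arity c' = arity c"
    using V_Comp.hyps by (auto simp: leaves_tgt)
  have "typed (subst_raw (V (Comp a' a) (Comp b' b) (Comp c' c) s u) cs)"
    using V_Comp subst_typed[of "V (Comp a' a) (Comp b' b) (Comp c' c) s u"] by simp
  then show ?case using ar by (simp add: eqv.V_Comp take_map drop_map)
next
  case (V_end a b c s)
  have "typed (subst_raw (V a b c s s) cs)"
    using V_end subst_typed[of "V a b c s s"] by simp
  then have "subst_raw (V a b c s s) cs \<sim> Vraw (subst_raw a (take (arity a) cs))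
       (subst_raw b (take (arity b) (drop (arity a) cs)))
       (subst_raw c (drop (arity a + arity b) cs)) s"
    by (simp add: eqv.V_end)
  then show ?case by (cases s) (simp_all add: Vraw_def take_drop drop_drop add.commute)
qed

lemma subst_rep:
  assumes "typed a" "typed_list cs (arity a)"
  shows "subst_raw (rep (cls a)) (map rep (map cls cs)) \<sim> subst_raw a cs"
proof -
  have t: "typed_list (map rep (map cls cs)) (arity a)"
    using assms(2) by (auto simp: typed_list_def)
  have "subst_raw (rep (cls a)) (map rep (map cls cs)) \<sim> subst_raw a (map rep (map cls cs))"
    using assms(1) t by (intro subst_eqv rep_eqv) simp_all
  also have "\<dots> \<sim> subst_raw a cs"
    using assms by (intro subst_cong_args t)
      (auto simp: list_all2_conv_all_nth typed_list_def intro: rep_eqv)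
  finally show ?thesis .
qed

lemma amap_Q: "typed a \<Longrightarrow> typed_list cs (arity a) \<Longrightarrow>
    amap (catalan_Q ms) (cls a, map cls cs) = cls (subst_raw a cs)"
  using eqv_cls[OF subst_rep] by (simp add: catalan_Q_def)

lemma Arr_list:
  assumes "list_all2 (\<lambda>f m. f \<in> Arr (catalan m)) fs ms"
  obtains cs where "fs = map cls cs" "typed_list cs (length ms)"
proof
  have "\<forall>f\<in>set fs. typed (rep f) \<and> cls (rep f) = f"
    using assms by (metis Arr_catalan in_set_conv_nth list_all2_conv_all_nth)
  then show "fs = map cls (map rep fs)" "typed_list (map rep fs) (length ms)"
    using assms by (auto simp: typed_list_def list_all2_lengthD intro!: map_idI[symmetric])
qed

text \<open>
  Substitution respects the congruence, so \<open>catalan_Q\<close> satisfies on arrows the recursion that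
  defines it on formal arrows.
\<close>

lemma catalan_Q_1:
  assumes "f \<in> Arr (catalan 1)" "g \<in> Arr (catalan t)"
  shows "amap (catalan_Q [t]) (f, [g]) = g"
proof -
  obtain c where c: "g = cls c" "typed c" by (rule Arr_catalanE[OF assms(2)])
  have "f = cls Star" using assms(1) catalan_1 by simp
  then show ?thesis using amap_Q[of Star "[c]"] c by (simp add: typed_list_def)
qed

lemma catalan_Q_U:
  assumes "f \<in> Arr (catalan (length ms))" "g \<in> Arr (catalan (length ns))"
    and "list_all2 (\<lambda>h m. h \<in> Arr (catalan m)) fs ms" "list_all2 (\<lambda>h n. h \<in> Arr (catalan n)) gs ns"
  shows "amap (catalan_Q (ms @ ns)) (amap Ufun (f, g), fs @ gs) =
    amap Ufun (amap (catalan_Q ms) (f, fs), amap (catalan_Q ns) (g, gs))"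
proof -
  obtain a where a: "f = cls a" "typed a" "arity a = length ms" by (rule Arr_catalanE[OF assms(1)])
  obtain b where b: "g = cls b" "typed b" "arity b = length ns" by (rule Arr_catalanE[OF assms(2)])
  obtain cs where cs: "fs = map cls cs" "typed_list cs (length ms)" by (rule Arr_list[OF assms(3)])
  obtain ds where ds: "gs = map cls ds" "typed_list ds (length ns)" by (rule Arr_list[OF assms(4)])
  have l: "length cs = length ms" "typed_list (cs @ ds) (length ms + length ns)"
    using cs ds by (auto simp: typed_list_def)
  have "amap (catalan_Q (ms @ ns)) (cls (U a b), map cls (cs @ ds)) = cls (subst_raw (U a b) (cs @ ds))"
    using a b l by (intro amap_Q) simp_all
  then show ?thesis
    using a b cs ds l subst_typed[of a cs] subst_typed[of b ds] by (simp add: amap_Ufun amap_Q)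
qed

lemma catalan_Q_V:
  assumes "f \<in> Arr (catalan (length ls))" "g \<in> Arr (catalan (length ms))" "h \<in> Arr (catalan (length ns))"
    and "list_all2 (\<lambda>h m. h \<in> Arr (catalan m)) fs ls" "list_all2 (\<lambda>h m. h \<in> Arr (catalan m)) gs ms"
    and "list_all2 (\<lambda>h m. h \<in> Arr (catalan m)) hs ns"
  shows "amap (catalan_Q (ls @ ms @ ns)) (amap Vfun (f, g, h, s, t), fs @ gs @ hs) =
    amap Vfun (amap (catalan_Q ls) (f, fs), amap (catalan_Q ms) (g, gs), amap (catalan_Q ns) (h, hs), s, t)"
proof -
  obtain a where a: "f = cls a" "typed a" "arity a = length ls" by (rule Arr_catalanE[OF assms(1)])
  obtain b where b: "g = cls b" "typed b" "arity b = length ms" by (rule Arr_catalanE[OF assms(2)])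
  obtain c where c: "h = cls c" "typed c" "arity c = length ns" by (rule Arr_catalanE[OF assms(3)])
  obtain cs where cs: "fs = map cls cs" "typed_list cs (length ls)" by (rule Arr_list[OF assms(4)])
  obtain ds where ds: "gs = map cls ds" "typed_list ds (length ms)" by (rule Arr_list[OF assms(5)])
  obtain es where es: "hs = map cls es" "typed_list es (length ns)" by (rule Arr_list[OF assms(6)])
  have l: "length cs = length ls" "length ds = length ms"
    "typed_list (cs @ ds @ es) (length ls + length ms + length ns)"
    using cs ds es by (auto simp: typed_list_def)
  have "amap (catalan_Q (ls @ ms @ ns)) (cls (V a b c s t), map cls (cs @ ds @ es)) =
      cls (subst_raw (V a b c s t) (cs @ ds @ es))"
    using a b c l by (intro amap_Q) simp_all
  then show ?thesis
    using a b c cs ds es l subst_typed[of a cs] subst_typed[of b ds] subst_typed[of c es]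
    by (simp add: amap_Vfun amap_Q)
qed

end

theory Submission
  imports Defs
begin

text \<open>\<open>Q\<close> is simultaneous substitution: trees, or formal arrows, are grafted onto
  the leaves of a tree or formal arrow. Two things make this an operad. Functoriality:
  \<open>subst_eqv\<close> and \<open>subst_cong_args\<close> make substitution independent of
  representatives, so \<open>amap_Q\<close> computes \<open>Q\<close> on classes, and
  \<open>subst_Comp\<close> is the interchange law giving preservation of composites.

  Associativity: grafting twice equals grafting the already grafted pieces. This is an equality of
  trees (\<open>subst_tree_assoc\<close>) and even of formal arrows
  (\<open>subst_raw_assoc\<close>), proved by structural induction. Both sides cut the list of
  outermost arguments at the same places, because the number of leaves after grafting is the sum of
  the numbers of leaves of the grafted pieces. Passing to classes in \<open>catalan_Q_assoc\<close>
  then yields the operad axiom.\<close>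

section \<open>Cutting lists into blocks\<close>

lemma length_chunks [simp]: "length (chunks js xs) = length js"
  by (induction js arbitrary: xs) auto

lemma chunks_map: "chunks js (map f xs) = map (map f) (chunks js xs)"
  by (induction js arbitrary: xs) (auto simp: take_map drop_map)

text \<open>The first \<open>n\<close> blocks use up exactly the entries counted by the first
  \<open>n\<close> sizes. With \<open>drop_chunks\<close>, this distributes the blocks over the
  subtrees of a node.\<close>

lemma take_chunks:
  "take n (chunks js xs) = chunks (take n js) (take (sum_list (take n js)) xs)"
proof (induction js arbitrary: n xs)
  case (Cons j js)
  then show ?case by (cases n) (auto simp: drop_take)
qed simp

lemma drop_chunks:
  "drop n (chunks js xs) = chunks (drop n js) (drop (sum_list (take n js)) xs)"
proof (induction js arbitrary: n xs)
  case (Cons j js)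
  then show ?case by (cases n) (auto simp: add.commute)
qed simp

lemma map_length_chunks: "sum_list js = length xs \<Longrightarrow> map length (chunks js xs) = js"
  by (induction js arbitrary: xs) auto

lemma concat_chunks: "sum_list js = length xs \<Longrightarrow> concat (chunks js xs) = xs"
  by (induction js arbitrary: xs) auto

lemma typed_list_chunks:
  assumes "typed_list cs (sum_list js)" "i < length js"
  shows "typed_list (chunks js cs ! i) (js ! i)"
proof -
  have l: "sum_list js = length cs" using assms by (simp add: typed_list_def)
  have "length (chunks js cs ! i) = js ! i"
    using map_length_chunks[OF l] assms(2) by (metis length_chunks nth_map)
  moreover have "set (chunks js cs ! i) \<subseteq> set cs"
    using concat_chunks[OF l] assms(2) by (metis UN_upper length_chunks nth_mem set_concat)
  ultimately show ?thesis using assms(1) by (auto simp: typed_list_def)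
qed

section \<open>Associativity of substitution for trees and formal arrows\<close>

lemma leaves_subst_tree:
  "length gs = leaves x \<Longrightarrow> leaves (subst_tree x gs) = sum_list (map leaves gs)"
proof (induction x arbitrary: gs)
  case Leaf
  then show ?case by (cases gs) auto
next
  case (Node x y)
  have "sum_list (map leaves gs) = sum_list (map leaves (take (leaves x) gs @ drop (leaves x) gs))"
    by simp
  then show ?case using Node by (simp del: append_take_drop_id)
qed

text \<open>At a node, the outer substitution cuts \<open>hs\<close> after the leaves of the grafted
  left subtree, and this is a boundary between blocks.\<close>

lemma subst_tree_assoc:
  assumes "length gs = leaves x" "length hs = sum_list (map leaves gs)"
  shows "subst_tree (subst_tree x gs) hs =
    subst_tree x (map2 subst_tree gs (chunks (map leaves gs) hs))"
  using assms
proof (induction x arbitrary: gs hs)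
  case Leaf
  then obtain g where "gs = [g]" by (cases gs) auto
  with Leaf show ?case by simp
next
  case (Node x y)
  let ?n = "leaves x"
  let ?s = "sum_list (map leaves (take ?n gs))"
  have s: "sum_list (map leaves gs) = ?s + sum_list (map leaves (drop ?n gs))"
    by (metis append_take_drop_id map_append sum_list_append)
  have "leaves (subst_tree x (take ?n gs)) = ?s"
    using Node.prems by (simp add: leaves_subst_tree)
  with Node s show ?case
    by (simp add: take_map drop_map take_zip drop_zip take_chunks drop_chunks)
qed

lemma arity_subst:
  assumes "typed a" "typed_list cs (arity a)"
  shows "arity (subst_raw a cs) = sum_list (map arity cs)"
  using subst_typed[OF assms] assms by (simp add: leaves_subst_tree typed_list_def comp_def)

text \<open>
  Associativity holds already for formal arrows: in the clause for \<open>Comp\<close> the right factor is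
  substituted with identities only, and substituting identities into an identity gives an identity.
\<close>

lemma subst_raw_assoc:
  assumes "typed a" "typed_list cs (arity a)" "typed_list ds (sum_list (map arity cs))"
  shows "subst_raw (subst_raw a cs) ds =
    subst_raw a (map2 subst_raw cs (chunks (map arity cs) ds))"
  using assms
proof (induction a arbitrary: cs ds)
  case Star
  then obtain c where "cs = [c]" by (cases cs) (auto simp: typed_list_def)
  with Star show ?case by (simp add: typed_list_def)
next
  case (U a b)
  let ?n = "arity a"
  let ?s = "sum_list (map arity (take ?n cs))"
  have s: "sum_list (map arity cs) = ?s + sum_list (map arity (drop ?n cs))"
    by (metis append_take_drop_id map_append sum_list_append)
  have "typed_list cs (arity a + arity b)" using U.prems by simp
  note t = typed_list_parts(1,2)[OF this]
  have "typed_list ds (?s + sum_list (map arity (drop ?n cs)))" using U.prems s by simp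
  note t' = typed_list_parts(1,2)[OF this]
  show ?case using U.IH(1)[OF _ t(1) t'(1)] U.IH(2)[OF _ t(2) t'(2)] U.prems(1) t
    by (simp add: arity_subst take_map drop_map take_zip drop_zip take_chunks drop_chunks)
next
  case (V a b c s t)
  let ?as = "take (arity a) cs" and ?bs = "take (arity b) (drop (arity a) cs)"
    and ?cs = "drop (arity a + arity b) cs"
  let ?i = "sum_list (map arity ?as)" and ?j = "sum_list (map arity ?bs)"
    and ?k = "sum_list (map arity ?cs)"
  have "cs = ?as @ ?bs @ ?cs"
    by (metis append_take_drop_id drop_drop add.commute)
  then have s: "sum_list (map arity cs) = ?i + ?j + ?k"
    by (metis map_append sum_list_append add.assoc)
  have "typed_list cs (arity a + arity b + arity c)" using V.prems by simp
  note t = typed_list_parts(3-5)[OF this]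
  have "typed_list ds (?i + ?j + ?k)" using V.prems s by simp
  note t' = typed_list_parts(3-5)[OF this]
  \<comment> \<open>The clause for \<open>V\<close> drops \<open>arity a + arity b\<close> entries
    at once. Splitting this into two successive drops makes both cuts block boundaries for
    \<open>drop_chunks\<close>; \<open>drop_drop\<close> would merge them again.\<close>
  have e: "drop (m + n) xs = drop n (drop m xs)" for m n and xs :: "'x list"
    by (simp add: add.commute)
  show ?case using V.IH(1)[OF _ t(1) t'(1)] V.IH(2)[OF _ t(2) t'(2)] V.IH(3)[OF _ t(3) t'(3)]
      V.prems(1) t
    by (simp add: e take_add arity_subst take_map drop_map take_zip drop_zip take_chunks drop_chunks
        del: drop_drop)
next
  case (Comp b a)
  have ar: "arity b = arity a" using Comp.prems by (simp add: leaves_tgt)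
  \<comment> \<open>The right factor \<open>a\<close> receives \<open>ids cs\<close> and then
    \<open>ids ds\<close> on one side, but the identities of the combined arguments on the other.
    This equation matches the two for the induction hypothesis at \<open>a\<close>.\<close>
  have "map2 subst_raw (ids cs) (chunks (map arity cs) (ids ds)) =
      ids (map2 subst_raw cs (chunks (map arity cs) ds))" (is "?l = ?r")
  proof (rule nth_equalityI)
    fix i assume "i < length ?l"
    then have i: "i < length cs" by simp
    let ?d = "chunks (map arity cs) ds ! i"
    have d: "typed_list ?d (arity (cs ! i))"
      using typed_list_chunks[OF Comp.prems(3)] i by simp
    have c: "typed (cs ! i)" using Comp.prems(2) i by (simp add: typed_list_def)
    have "subst_raw (ident (src (cs ! i))) (map ident (map src ?d)) = ident (src (subst_raw (cs ! i) ?d))"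
      using subst_typed[OF c d] d by (subst subst_ident) (simp_all add: typed_list_def)
    then show "?l ! i = ?r ! i" using i by (simp add: chunks_map comp_def)
  qed simp
  then show ?case
    using Comp.IH(1)[of cs ds] Comp.IH(2)[of "ids cs" "ids ds"] Comp.prems ar
    by (simp add: typed_list_ids comp_def)
qed

section \<open>Functoriality of the composition maps\<close>

text \<open>Equality of lists is entrywise, so every axiom reduces to the same axiom in each
  factor.\<close>

lemma category_list:
  assumes "\<forall>C\<in>set Cs. category C"
  shows "category (list_cat Cs)"
proof -
  have "category (Cs ! i)" if "i < length Cs" for i using assms that by simp
  note c = this[unfolded category_def]
  have 1: "Dom (list_cat Cs) f \<in> Obj (list_cat Cs) \<and> Cod (list_cat Cs) f \<in> Obj (list_cat Cs)"
    if "f \<in> Arr (list_cat Cs)" for f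
    using that c by (simp add: list_cat_def list_all2_conv_all_nth)
  have 2: "Idn (list_cat Cs) x \<in> Arr (list_cat Cs) \<and> Dom (list_cat Cs) (Idn (list_cat Cs) x) = x \<and>
      Cod (list_cat Cs) (Idn (list_cat Cs) x) = x" if "x \<in> Obj (list_cat Cs)" for x
    using that c by (auto simp: list_cat_def list_all2_conv_all_nth intro!: nth_equalityI)
  have 3: "Cmp (list_cat Cs) g f \<in> Arr (list_cat Cs) \<and>
      Dom (list_cat Cs) (Cmp (list_cat Cs) g f) = Dom (list_cat Cs) f \<and>
      Cod (list_cat Cs) (Cmp (list_cat Cs) g f) = Cod (list_cat Cs) g"
    if "g \<in> Arr (list_cat Cs)" "f \<in> Arr (list_cat Cs)" "Dom (list_cat Cs) g = Cod (list_cat Cs) f"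
    for g f
  proof -
    have l: "length g = length Cs" "length f = length Cs"
      using that by (auto simp: list_cat_def list_all2_conv_all_nth)
    have "g ! i \<in> Arr (Cs ! i)" "f ! i \<in> Arr (Cs ! i)" "Dom (Cs ! i) (g ! i) = Cod (Cs ! i) (f ! i)"
      if "i < length Cs" for i
      using that l \<open>g \<in> _\<close> \<open>f \<in> _\<close> arg_cong[OF \<open>Dom _ g = _\<close>, of "\<lambda>xs. xs ! i"]
      by (auto simp: list_cat_def list_all2_conv_all_nth)
    with l c show ?thesis
      by (auto simp: list_cat_def list_all2_conv_all_nth intro!: nth_equalityI)
  qed
  have 4: "Cmp (list_cat Cs) (Idn (list_cat Cs) (Cod (list_cat Cs) f)) f = f \<and>
      Cmp (list_cat Cs) f (Idn (list_cat Cs) (Dom (list_cat Cs) f)) = f"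
    if "f \<in> Arr (list_cat Cs)" for f
    using that c by (auto simp: list_cat_def list_all2_conv_all_nth intro!: nth_equalityI)
  have 5: "Cmp (list_cat Cs) (Cmp (list_cat Cs) h g) f = Cmp (list_cat Cs) h (Cmp (list_cat Cs) g f)"
    if "h \<in> Arr (list_cat Cs)" "g \<in> Arr (list_cat Cs)" "f \<in> Arr (list_cat Cs)"
      "Dom (list_cat Cs) h = Cod (list_cat Cs) g" "Dom (list_cat Cs) g = Cod (list_cat Cs) f" for h g f
  proof -
    have l: "length h = length Cs" "length g = length Cs" "length f = length Cs"
      using that by (auto simp: list_cat_def list_all2_conv_all_nth)
    have "h ! i \<in> Arr (Cs ! i)" "g ! i \<in> Arr (Cs ! i)" "f ! i \<in> Arr (Cs ! i)"
      "Dom (Cs ! i) (h ! i) = Cod (Cs ! i) (g ! i)" "Dom (Cs ! i) (g ! i) = Cod (Cs ! i) (f ! i)"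
      if "i < length Cs" for i
      using that l \<open>h \<in> _\<close> \<open>g \<in> _\<close> \<open>f \<in> _\<close> arg_cong[OF \<open>Dom _ h = _\<close>, of "\<lambda>xs. xs ! i"]
        arg_cong[OF \<open>Dom _ g = _\<close>, of "\<lambda>xs. xs ! i"]
      by (auto simp: list_cat_def list_all2_conv_all_nth)
    with l c show ?thesis
      by (auto simp: list_cat_def list_all2_conv_all_nth intro!: nth_equalityI)
  qed
  show ?thesis
    unfolding category_def using 1 2 3 4 5 by blast
qed

text \<open>Sharpens \<open>Arr_list\<close>: congruent formal arrows have the same arity, so the
  representatives retain the sizes \<open>ms\<close>, which are the block sizes in
  \<open>subst_raw_assoc\<close>.\<close>

lemma Arr_list_arity:
  assumes "fs \<in> Arr (list_cat (map catalan ms))"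
  obtains cs where "fs = map cls cs" "typed_list cs (length ms)" "map arity cs = ms"
proof -
  have a: "list_all2 (\<lambda>f m. f \<in> Arr (catalan m)) fs ms"
    using assms by (simp add: list_cat_def list.rel_map)
  obtain cs where cs: "fs = map cls cs" "typed_list cs (length ms)" by (rule Arr_list[OF a])
  have "map arity cs = ms"
  proof (rule nth_equalityI)
    show "length (map arity cs) = length ms" using cs by (simp add: typed_list_def)
    fix i assume i: "i < length (map arity cs)"
    then have "cls (cs ! i) \<in> Arr (catalan (ms ! i))" "typed (cs ! i)"
      using a cs by (auto simp: list_all2_conv_all_nth typed_list_def)
    then show "map arity cs ! i = ms ! i" using i Arr_catalan rep_cls by (metis length_map nth_map)
  qed
  with cs that show thesis by blast
qed

lemma Obj_list: "gs \<in> Obj (list_cat (map catalan ms)) \<longleftrightarrow> map leaves gs = ms"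
  by (auto simp: list_cat_def list_all2_conv_all_nth list_eq_iff_nth_eq)

lemma list_cat_catalan:
  assumes "typed_list cs (length ms)"
  shows "Dom (list_cat (map catalan ms)) (map cls cs) = map src cs"
    "Cod (list_cat (map catalan ms)) (map cls cs) = map tgt cs"
    "length gs = length ms \<Longrightarrow> Idn (list_cat (map catalan ms)) gs = map cls (map ident gs)"
    "composable ds cs (length ms) \<Longrightarrow>
      Cmp (list_cat (map catalan ms)) (map cls ds) (map cls cs) = map cls (comps ds cs)"
proof -
  show "Dom (list_cat (map catalan ms)) (map cls cs) = map src cs"
    "Cod (list_cat (map catalan ms)) (map cls cs) = map tgt cs"
    using assms by (auto simp: list_cat_def list_eq_iff_nth_eq typed_list_def)
  show "length gs = length ms \<Longrightarrow> Idn (list_cat (map catalan ms)) gs = map cls (map ident gs)"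
    by (auto simp: list_cat_def list_eq_iff_nth_eq)
  show "composable ds cs (length ms) \<Longrightarrow>
      Cmp (list_cat (map catalan ms)) (map cls ds) (map cls cs) = map cls (comps ds cs)"
    by (auto simp: list_cat_def list_eq_iff_nth_eq typed_list_def composable_def Cmp_catalan)
qed

lemma omap_Q [simp]: "omap (catalan_Q ms) (x, gs) = subst_tree x gs"
  by (simp add: catalan_Q_def)

text \<open>Identities are preserved by \<open>subst_ident\<close>, sources and targets by
  \<open>subst_typed\<close>, and composites by the interchange law
  \<open>subst_Comp\<close>.\<close>

lemma catalan_Q_functor:
  "is_functor (prod_cat (catalan (length js)) (list_cat (map catalan js))) (catalan (sum_list js))
     (catalan_Q js)"
  (is "is_functor ?P _ _")
proof -
  have arr: "\<exists>a cs. f = (cls a, map cls cs) \<and> typed a \<and> arity a = length js \<and>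
      typed_list cs (length js)" if "f \<in> Arr ?P" for f
    using that by (auto simp: prod_cat_def elim!: Arr_catalanE Arr_list_arity)
  show ?thesis
  proof (rule catalan_functorI, goal_cases)
    case 1
    then show ?case by (auto intro!: category_prod category_catalan category_list)
  next
    case (2 p)
    then obtain x gs where p: "p = (x, gs)" "leaves x = length js" "map leaves gs = js"
      by (auto simp: prod_cat_def Obj_list)
    then have l: "length gs = leaves x" by auto
    have "typed_list (map ident gs) (length gs)" by (auto simp: typed_list_def)
    then show ?case using p l
      by (simp add: leaves_subst_tree prod_cat_def list_cat_catalan(3)[of "map ident gs" js]
          amap_Q subst_ident del: map_map)
  next
    case (3 f)
    then obtain a cs where f: "f = (cls a, map cls cs)" "typed a" "arity a = length js"
      "typed_list cs (length js)" using arr by blast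
    then show ?case using subst_typed[of a cs]
      by (auto simp: amap_Q prod_cat_def list_cat_catalan intro!: exI[of _ "subst_raw a cs"])
  next
    case (4 g f a' b')
    obtain a cs where f: "f = (cls a, map cls cs)" "typed a" "arity a = length js"
      "typed_list cs (length js)" using arr 4(2) by blast
    obtain b ds where g: "g = (cls b, map cls ds)" "typed b" "arity b = length js"
      "typed_list ds (length js)" using arr 4(1) by blast
    have m: "src b = tgt a" "map src ds = map tgt cs"
      using 4(3) f g by (auto simp: prod_cat_def list_cat_catalan)
    have c: "composable ds cs (length js)" using f g m by (simp add: composable_def)
    have t: "typed (subst_raw a cs)" "typed (subst_raw b ds)"
      using subst_typed f g by simp_all
    \<comment> \<open>\<open>catalan_functorI\<close> supplies arbitrary representatives
      \<open>a'\<close> and \<open>b'\<close> of the two images; they are congruent to the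
      substituted arrows.\<close>
    have q: "subst_raw b ds \<sim> b'" "subst_raw a cs \<sim> a'"
      using 4(4,5) f g t by (simp_all add: amap_Q cls_eq)
    have "subst_raw (Comp b a) (comps ds cs) \<sim> Comp (subst_raw b ds) (subst_raw a cs)"
      using f g m c by (intro subst_Comp) simp_all
    also have "\<dots> \<sim> Comp b' a'"
      using q 4(6) eqv_wf[OF q(1)] eqv_wf[OF q(2)] by (intro Comp_cong) simp_all
    finally have "cls (subst_raw (Comp b a) (comps ds cs)) = cls (Comp b' a')" by (rule eqv_cls)
    then show ?case using f g m c composable_comps(1)[OF c]
      by (simp add: prod_cat_def Cmp_catalan list_cat_catalan amap_Q del: map_map)
  qed
qed

section \<open>The operad axiom\<close>

lemma catalan_Q_assoc:
  fixes js "is" :: "nat list"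
  assumes "length is = sum_list js"
  shows "functor_eq
     (prod_cat (prod_cat (catalan (length js)) (list_cat (map catalan js))) (list_cat (map catalan is)))
     (comp_functor (catalan_Q is) (prod_functor (catalan_Q js) id_functor))
     (comp_functor (catalan_Q (map sum_list (chunks js is)))
       (comp_functor (prod_functor id_functor (list_functor (map catalan_Q (chunks js is))))
         (shuffle_functor js)))"
  (is "functor_eq ?P ?F ?G")
  unfolding functor_eq_def
proof (intro conjI ballI)
  fix p assume "p \<in> Obj ?P"
  then obtain x gs hs where p: "p = ((x, gs), hs)"
    and l: "leaves x = length js" "map leaves gs = js" "map leaves hs = is"
    by (auto simp: prod_cat_def Obj_list)
  have len: "length gs = length js" "length hs = sum_list js" using l assms by auto
  have "map2 omap (map catalan_Q (chunks js is)) (zip gs (chunks js hs)) =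
      map2 subst_tree gs (chunks js hs)"
    using len by (intro nth_equalityI) simp_all
  then show "omap ?F p = omap ?G p"
    using subst_tree_assoc[of gs x hs] l len p
    by (simp add: comp_functor_def prod_functor_def id_functor_def list_functor_def
        shuffle_functor_def shuffle_def)
next
  fix f assume "f \<in> Arr ?P"
  then obtain f0 fs gs where f0: "f = ((f0, fs), gs)" "f0 \<in> Arr (catalan (length js))"
    "fs \<in> Arr (list_cat (map catalan js))" "gs \<in> Arr (list_cat (map catalan is))"
    by (auto simp: prod_cat_def)
  obtain a where a: "f0 = cls a" "typed a" "arity a = length js" by (rule Arr_catalanE[OF f0(2)])
  obtain cs where cs: "fs = map cls cs" "typed_list cs (length js)" "map arity cs = js"
    by (rule Arr_list_arity[OF f0(3)])
  obtain ds where ds: "gs = map cls ds" "typed_list ds (length is)"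
    by (rule Arr_list_arity[OF f0(4)])
  have f: "f = ((cls a, map cls cs), map cls ds)" using f0 a cs ds by simp
  have len: "length cs = length js" using cs by (simp add: typed_list_def)
  have ds': "typed_list ds (sum_list (map arity cs))" using ds cs assms by simp
  let ?es = "map2 subst_raw cs (chunks js ds)"
  \<comment> \<open>Each block has as many entries as the arity of the arrow it is substituted into,
    so \<open>amap_Q\<close> applies block by block.\<close>
  have chunk: "typed (cs ! i)" "typed_list (chunks js ds ! i) (arity (cs ! i))"
    if i: "i < length js" for i
  proof -
    show "typed (cs ! i)" using cs(2) i len by (metis typed_list_def nth_mem)
    have "js ! i = arity (cs ! i)" using cs(3) i len by (metis nth_map)
    moreover have "typed_list (chunks js ds ! i) (js ! i)"
      using ds(2) assms i by (intro typed_list_chunks) simp_all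
    ultimately show "typed_list (chunks js ds ! i) (arity (cs ! i))" by (rule subst)
  qed
  \<comment> \<open>After the shuffle, the product of the inner functors \<open>Q\<close> has the
    formal substitutions \<open>?es\<close> as representatives, so that both composites become
    classes compared by \<open>subst_raw_assoc\<close>.\<close>
  have e: "map2 amap (map catalan_Q (chunks js is)) (zip (map cls cs) (chunks js (map cls ds))) =
      map cls ?es"
    using len chunk by (intro nth_equalityI) (simp_all add: chunks_map amap_Q)
  have es: "typed_list ?es (arity a)"
    unfolding typed_list_def[of ?es] using len a subst_typed[OF chunk] by (auto simp: set_zip)
  have "amap ?F f = cls (subst_raw (subst_raw a cs) ds)"
    using f a cs ds' subst_typed[of a cs] arity_subst[of a cs]
    by (simp add: comp_functor_def prod_functor_def id_functor_def amap_Q)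
  also have "\<dots> = cls (subst_raw a ?es)"
    using subst_raw_assoc[of a cs ds] a cs ds' by simp
  also have "\<dots> = amap (catalan_Q (map sum_list (chunks js is))) (cls a, map cls ?es)"
    using a es by (simp add: amap_Q del: map_map)
  also have "\<dots> = amap ?G f"
    unfolding e[symmetric] f
    by (simp add: comp_functor_def prod_functor_def id_functor_def list_functor_def
        shuffle_functor_def shuffle_def)
  finally show "amap ?F f = amap ?G f" .
qed

theorem proposition2:
  shows "operad_in_Cat catalan catalan_Q"
  unfolding operad_in_Cat_def
  using category_catalan catalan_Q_functor catalan_Q_assoc by blast

end
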